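(* For every $\Delta>0$ and every $r>0$ there exist a constant $A_{\Delta,r}>0$ and an integer $N_{\Delta,r}$ such that for all $N>N_{\Delta,r}$, $$\mathrm{Prob}\left(\left|\Xi_{\alpha,r,N}-\frac{Nr^2}{1+r^2}\right|\ge \Delta N\right)\le e^{-A_{\Delta,r}N^2},$$ where $\Xi_{\alpha,r,N}$ denotes the number of zeros, counted with multiplicity, of the Gaussian random SU(2) polynomial $\psi_{\alpha,N}$ in the disk $B(0,r)$.
   Context: For an integer $N\ge 1$, the Gaussian random SU(2) polynomial of degree $N$ is $\psi_{\alpha,N}(z)=\sum_{j=0}^N \alpha_j\sqrt{\binom{N}{j}}\,z^j$, $z\in\mathbb{C}$, where $\alpha=(\alpha_0,\dots,\alpha_N)$ and the $\alpha_j$ are independent identically distributed standard complex Gaussian random variables (mean $0$, variance $1$, i.e. density $\frac1\pi e^{-|w|^2}$ on $\mathbb{C}$, so that $\mathrm{Prob}(|\alpha_j|\ge\lambda)=e^{-\lambda^2}$ for $\lambda\ge 0$). $B(0,r)$ is the disk in $\mathbb{C}$ of radius $r$ centered at $0$ (the event that a zero lies on its boundary is null). *)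

theory Defs
  imports
    "HOL-Probability.Probability"
    "HOL-Computational_Algebra.Polynomial"
begin

(* lborel on complex is the area measure dx dy, since {1, \<i>} is an orthonormal basis.
   Here E X = 0 and E |X|^2 = 1. *)
definition std_complex_gaussian :: "'a measure \<Rightarrow> ('a \<Rightarrow> complex) \<Rightarrow> bool" where
  "std_complex_gaussian M X \<longleftrightarrow>
     distributed M lborel X (\<lambda>w. ennreal (exp (- (cmod w)\<^sup>2) / pi))"

definition iid_std_complex_gaussian ::
  "'a measure \<Rightarrow> nat \<Rightarrow> (nat \<Rightarrow> 'a \<Rightarrow> complex) \<Rightarrow> bool" where
  "iid_std_complex_gaussian M N \<alpha> \<longleftrightarrow>
     prob_space.indep_vars M (\<lambda>_. borel) \<alpha> {..N} \<and>
     (\<forall>j\<le>N. std_complex_gaussian M (\<alpha> j))"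

definition su2_poly :: "nat \<Rightarrow> (nat \<Rightarrow> complex) \<Rightarrow> complex poly" where
  "su2_poly N a = (\<Sum>j\<le>N. monom (a j * complex_of_real (sqrt (real (N choose j)))) j)"

lemma poly_su2_poly:
  "poly (su2_poly N a) z = (\<Sum>j\<le>N. a j * complex_of_real (sqrt (real (N choose j))) * z ^ j)"
  by (simp add: su2_poly_def poly_sum poly_monom)

(* proots p is the multiset of zeros of p, each with its multiplicity.  The zero polynomial
   has proots 0 = {#}; for the random polynomial this is a null event. *)
definition zeros_in_disk :: "real \<Rightarrow> complex poly \<Rightarrow> nat" where
  "zeros_in_disk r p = size (filter_mset (\<lambda>z. z \<in> ball 0 r) (proots p))"

lemma zeros_in_disk_eq_sum_order:
  assumes "p \<noteq> 0"
  shows "zeros_in_disk r p = (\<Sum>z | z \<in> ball 0 r \<and> poly p z = 0. order z p)"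
  unfolding zeros_in_disk_def size_multiset_overloaded_eq
  using assms by (intro sum.cong) (auto simp: count_filter_mset)

end

theory Submission
  imports
    Defs
    "HOL-Computational_Algebra.Fundamental_Theorem_Algebra"
    "HOL-Real_Asymp.Real_Asymp"
begin

text \<open>
  Let \<open>K(s) = \<bar>c\<bar> \<Prod>\<^sub>z max s \<bar>z\<bar>\<close>, with \<open>c\<close> the leading coefficient and \<open>z\<close> running through the zeros.
  Since \<open>ln K\<close> is convex in \<open>ln s\<close> with slope the number of zeros in \<open>B(0,s)\<close>, that number is
  squeezed between difference quotients of \<open>ln K\<close>. So it suffices that, for fixed \<open>s\<close>, \<open>ln K(s)\<close> is within
  \<open>\<delta> N\<close> of \<open>(N/2) ln (1 + s\<^sup>2)\<close> outside an event of probability \<open>exp (-A N\<^sup>2)\<close>.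

  Upper bound: \<open>K(s)\<close> is at most the maximum on the circle of radius \<open>s\<close>, and all coefficients are
  bounded by \<open>N\<close> with the required probability. Lower bound: up to a factor \<open>3\<^bsup>N/m\<^esup>\<close>, \<open>K(s)\<close>
  dominates the geometric mean of the moduli of the values at any \<open>m\<close> points close to the equidistributed points on the
  circle. Near each of these points the polynomial is not exponentially small: otherwise
  about \<open>\<kappa> N\<close> linear functionals of the coefficients, triangular in a block of \<open>\<kappa> N\<close> indices around the mode of the
  binomial weights, would all be exponentially small.
\<close>

section \<open>Roots of unity and the Mahler measure on circles\<close>

definition unit_root :: "nat \<Rightarrow> nat \<Rightarrow> complex" where
  "unit_root m k = cis (2 * pi * real k / real m)"

lemma norm_unit_root [simp]: "cmod (unit_root m k) = 1"
  by (simp add: unit_root_def)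

lemma unit_root_nonzero [simp]: "unit_root m k \<noteq> 0"
  by (simp add: unit_root_def)

text \<open>Orthogonality of the characters of Z/m, with the negative power written as a quotient.
  Exponents below \<open>m\<close> are congruent modulo \<open>m\<close> only if they are
  equal.\<close>

lemma sum_unit_root_power_quotient:
  assumes "a < m" "b < m"
  shows "(\<Sum>k<m. unit_root m k ^ a / unit_root m k ^ b) = (if a = b then of_nat m else 0)"
proof (cases "a = b")
  case False
  define x where "x = cis (2 * pi * (real a - real b) / real m)"
  have m: "m > 0" using assms by simp
  have quot: "unit_root m k ^ a / unit_root m k ^ b = x ^ k" for k
    unfolding unit_root_def x_def Complex.DeMoivre cis_divide
    by (rule arg_cong[where f = cis]) (simp add: algebra_simps diff_divide_distrib)
  have "x \<noteq> 1"
  proof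
    assume "x = 1"
    then obtain j :: int where "2 * pi * (real a - real b) / real m = j * 2 * pi"
      by (auto simp: x_def complex_eq_iff cos_one_2pi_int)
    hence "2 * pi * (real a - real b) = 2 * pi * (real_of_int j * real m)"
      using m by (simp add: field_simps)
    hence "real_of_int (int a - int b) = real_of_int (j * int m)"
      by simp
    hence "int a - int b = j * int m" by (simp only: of_int_eq_iff)
    hence "\<bar>int a - int b\<bar> = \<bar>j\<bar> * int m" by (simp add: abs_mult)
    moreover have "\<bar>int a - int b\<bar> < int m" using assms by linarith
    moreover have "\<bar>j\<bar> \<ge> 1" using calculation False by (cases "j = 0") auto
    ultimately show False
      by (metis abs_ge_zero mult_le_cancel_right1 not_le of_nat_less_0_iff)
  qed
  moreover have "x ^ m = 1"
  proof -
    have "x ^ m = cis (2 * pi * (real_of_int (int a - int b)))"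
      using m by (simp add: x_def Complex.DeMoivre)
    also have "\<dots> = 1" by (rule cis_multiple_2pi) simp
    finally show ?thesis .
  qed
  ultimately show ?thesis using False unfolding quot
    by (simp add: geometric_sum)
qed simp

text \<open>Rescaled to \<open>s = 1\<close>, both sides are monic polynomials of degree
  \<open>m\<close> in \<open>w\<close> that vanish at the \<open>m\<close> roots of unity.\<close>

lemma prod_diff_unit_root:
  fixes w :: complex and s :: real
  assumes "m > 0" "s > 0"
  shows "(\<Prod>k<m. w - of_real s * unit_root m k) = w ^ m - of_real s ^ m"
proof -
  define p where "p = (\<Prod>k<m. [:- unit_root m k, 1:])"
  define q :: "complex poly" where "q = monom 1 m - 1"
  have bij: "bij_betw (unit_root m) {..<m} {z. z ^ m = 1}"
    using Complex.bij_betw_roots_unity[OF assms(1)] unfolding unit_root_def .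
  have deg: "degree p = m"
    by (simp add: p_def degree_prod_sum_eq)
  have "lead_coeff p = 1"
    by (simp add: p_def lead_coeff_prod)
  hence "coeff p m = coeff q m"
    using assms by (simp add: deg q_def coeff_eq_0)
  moreover have "degree q \<le> m"
    unfolding q_def by (rule degree_diff_le) (auto simp: degree_monom_le)
  moreover have "poly p z = poly q z" if "z \<in> {z. z ^ m = 1}" for z
  proof -
    from that bij have "z \<in> unit_root m ` {..<m}"
      by (simp add: bij_betw_def)
    then obtain k where "k < m" "unit_root m k = z" by auto
    thus ?thesis using that by (auto simp: p_def q_def poly_prod poly_monom)
  qed
  ultimately have "p = q"
    using card_roots_unity_eq[OF assms(1)] deg
    by (intro poly_eqI_degree_lead_coeff[where n = m and A = "{z. z ^ m = 1}"]) auto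
  hence "poly p (w / of_real s) = poly q (w / of_real s)" by simp
  hence eq: "(\<Prod>k<m. w / of_real s - unit_root m k) = (w / of_real s) ^ m - 1"
    by (simp add: p_def q_def poly_prod poly_monom)
  have "(\<Prod>k<m. w - of_real s * unit_root m k)
      = (\<Prod>k<m. of_real s * (w / of_real s - unit_root m k))"
    using assms by (intro prod.cong) (auto simp: field_simps)
  also have "\<dots> = of_real s ^ m * ((w / of_real s) ^ m - 1)"
    by (simp only: prod.distrib eq) simp
  also have "\<dots> = w ^ m - of_real s ^ m"
    using assms by (simp add: field_simps)
  finally show ?thesis .
qed

text \<open>Averaging over more equally spaced nodes than the degree kills every power except the
  constant one, so the constant coefficient is an exact mean of values on the circle. This replaces
  the maximum principle at 0.\<close>

lemma norm_coeff_0_le_max_circle: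
  fixes p :: "complex poly" and s B :: real
  assumes "\<And>z. cmod z = s \<Longrightarrow> cmod (poly p z) \<le> B" "s > 0"
  shows "cmod (coeff p 0) \<le> B"
proof -
  define m where "m = Suc (degree p)"
  let ?z = "\<lambda>k. of_real s * unit_root m k"
  have "(\<Sum>k<m. poly p (?z k))
      = (\<Sum>i\<le>degree p. coeff p i * of_real s ^ i * (\<Sum>k<m. unit_root m k ^ i / unit_root m k ^ 0))"
    by (simp add: poly_altdef sum_distrib_left power_mult_distrib mult_ac sum.swap[of _ "{..<m}"])
  also have "\<dots> = (\<Sum>i\<le>degree p. coeff p i * of_real s ^ i * (if i = 0 then of_nat m else 0))"
    by (intro sum.cong refl) (subst sum_unit_root_power_quotient, auto simp: m_def)
  also have "\<dots> = of_nat m * coeff p 0"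
    by (simp add: if_distrib cong: if_cong)
  finally have "real m * cmod (coeff p 0) = cmod (\<Sum>k<m. poly p (?z k))"
    by (simp add: norm_mult)
  also have "\<dots> \<le> (\<Sum>k<m. B)"
    by (rule sum_norm_le) (use assms in \<open>auto simp: norm_mult\<close>)
  finally show ?thesis by (simp add: m_def)
qed

section \<open>Mahler measure on a circle and its discrete approximations\<close>

text \<open>For nonzero \<open>p\<close> and positive \<open>s\<close>, Jensen's formula identifies
  this with the exponential of the mean of ln |p| on the circle of radius \<open>s\<close>. The
  product form needs no integral and makes the dependence on \<open>s\<close> explicit.\<close>

definition mahler :: "real \<Rightarrow> complex poly \<Rightarrow> real" where
  "mahler s p = cmod (lead_coeff p) * (\<Prod>z\<in>#proots p. max s (cmod z))"

lemma norm_poly_eq_prod_proots: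
  "cmod (poly p z) = cmod (lead_coeff p) * (\<Prod>w\<in>#proots p. cmod (z - w))"
proof -
  have "poly p z = poly (smult (lead_coeff p) (\<Prod>w\<in>#proots p. [:-w, 1:])) z"
    by (simp only: complex_poly_decompose_multiset)
  also have "\<dots> = lead_coeff p * (\<Prod>w\<in>#proots p. z - w)"
    by (simp add: poly_prod_mset image_mset.compositionality o_def)
  also have "cmod \<dots> = cmod (lead_coeff p) * (\<Prod>w\<in>#proots p. cmod (z - w))"
  proof -
    have "cmod (\<Prod>w\<in>#A. z - w) = (\<Prod>w\<in>#A. cmod (z - w))" for A
      by (induction A) (auto simp: norm_mult)
    thus ?thesis by (simp add: norm_mult)
  qed
  finally show ?thesis .
qed

lemma prod_mset_cmod_nonneg: "(\<Prod>w\<in>#A. cmod (f w)) \<ge> 0"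
  by (induction A) auto

lemma prod_mset_max_pos:
  "s > 0 \<Longrightarrow> (\<Prod>z\<in>#A. max s (cmod z)) > 0"
  by (induction A) (auto intro!: mult_pos_pos simp: less_max_iff_disj)

lemma mahler_pos: "p \<noteq> 0 \<Longrightarrow> s > 0 \<Longrightarrow> mahler s p > 0"
  using prod_mset_max_pos[of s "proots p"] by (simp add: mahler_def)

text \<open>Reflecting the roots inside the disk in the circle does not change the modulus on the circle
  and turns the value at \<open>0\<close> into the Mahler measure.\<close>

lemma mahler_le_max_circle:
  assumes "\<And>z. cmod z = s \<Longrightarrow> cmod (poly p z) \<le> B" "s > 0"
  shows "mahler s p \<le> B"
proof -
  define f :: "complex \<Rightarrow> complex poly" where
    "f w = (if cmod w < s then [:of_real s, - cnj w / of_real s:] else [:-w, 1:])" for w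
  define g where "g = smult (lead_coeff p) (\<Prod>w\<in>#proots p. f w)"
  have f: "cmod (poly (f w) z) = cmod (z - w)" if "cmod z = s" for w z
  proof (cases "cmod w < s")
    case True
    \<comment> \<open>On the circle the conjugate of \<open>z\<close> is s^2 / z, which turns the
      reflected factor into \<open>z / s\<close> times the conjugate of
      \<open>z - w\<close>.\<close>
    have "cnj z * z = of_real s ^ 2"
      using that complex_norm_square[of z] by (simp add: mult.commute)
    hence "poly (f w) z = z / of_real s * cnj (z - w)"
      using True \<open>s > 0\<close> by (simp add: f_def field_simps power2_eq_square)
    thus ?thesis using that \<open>s > 0\<close>
      by (simp only: norm_mult norm_divide complex_mod_cnj) simp
  qed (simp add: f_def)
  have g: "cmod (poly g z) = cmod (lead_coeff p) * (\<Prod>w\<in>#proots p. cmod (poly (f w) z))" for z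
  proof -
    have "cmod (poly (\<Prod>w\<in>#A. f w) z) = (\<Prod>w\<in>#A. cmod (poly (f w) z))" for A
      by (induction A) (auto simp: norm_mult)
    thus ?thesis by (simp add: g_def norm_mult)
  qed
  have "cmod (poly g z) \<le> B" if "cmod z = s" for z
    unfolding g f[OF that] norm_poly_eq_prod_proots[symmetric] by (rule assms(1)) fact
  hence "cmod (coeff g 0) \<le> B"
    using assms(2) by (rule norm_coeff_0_le_max_circle)
  also have "coeff g 0 = poly g 0" by (simp add: poly_0_coeff_0)
  also have "cmod \<dots> = mahler s p"
    unfolding g mahler_def using \<open>s > 0\<close>
    by (intro arg_cong2[where f = "(*)"] arg_cong[where f = prod_mset] image_mset_cong refl)
       (auto simp: f_def)
  finally show ?thesis .
qed

text \<open>Exact equidistribution would give \<open>\<bar>w ^ m - s ^ m\<bar> \<le> 2 * max s \<bar>w\<bar> ^ m\<close>; the constant 3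
  leaves room for perturbing the nodes.\<close>

lemma prod_perturbed_unit_roots_le:
  fixes s \<eta> :: real and z :: "nat \<Rightarrow> complex"
  assumes "m > 0" "s > 0" "\<eta> \<le> s / (real m * 3 ^ m)"
    and z: "\<And>k. k < m \<Longrightarrow> cmod (z k - of_real s * unit_root m k) \<le> \<eta>"
  shows "(\<Prod>k<m. cmod (z k - w)) \<le> 3 * max s (cmod w) ^ m"
proof -
  define X where "X = max s (cmod w)"
  have X: "X > 0" "s \<le> X" "cmod w \<le> X" using assms by (auto simp: X_def)
  let ?u = "\<lambda>k. of_real s * unit_root m k"
  have "\<eta> \<le> s" 
  proof -
    have "1 \<le> real m * 3 ^ m" using assms(1) one_le_power[of "3::real" m]
      by (metis One_nat_def Suc_leI mult_mono[of 1 "real m" 1 "3^m"] mult_1 numeral_le_iff of_nat_0_le_iff of_nat_1 of_nat_mono one_le_numeral zero_le_one)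
    hence "s / (real m * 3 ^ m) \<le> s" using assms(2) by (simp add: field_simps)
    thus ?thesis using assms(3) by linarith
  qed
  have u: "cmod (w - ?u k) \<le> 2 * X" for k
    using norm_triangle_ineq4[of w "?u k"] X assms(2) by (simp add: norm_mult)
  have zw: "cmod (w - z k) \<le> 3 * X" if "k < m" for k
  proof -
    have "w - z k = (w - ?u k) - (z k - ?u k)" by simp
    hence "cmod (w - z k) \<le> cmod (w - ?u k) + cmod (z k - ?u k)"
      by (metis norm_triangle_ineq4)
    thus ?thesis using u[of k] z[OF that] X \<open>\<eta> \<le> s\<close> by linarith
  qed
  \<comment> \<open>After division by \<open>3 * X\<close> all factors lie in the closed unit disk,
    where two products differ by at most the sum of the differences of their factors.\<close>
  define a where "a k = (w - z k) / of_real (3 * X)" for k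
  define b where "b k = (w - ?u k) / of_real (3 * X)" for k
  have "cmod ((\<Prod>k<m. a k) - (\<Prod>k<m. b k)) \<le> (\<Sum>k<m. cmod (a k - b k))"
  proof (rule norm_prod_diff)
    show "cmod (a k) \<le> 1" if "k \<in> {..<m}" for k
      using zw[of k] that X by (simp add: a_def norm_divide norm_mult)
    show "cmod (b k) \<le> 1" for k
      using u[of k] X by (simp add: b_def norm_divide norm_mult)
  qed
  also have "\<dots> \<le> (\<Sum>k<m. \<eta> / (3 * X))"
  proof (rule sum_mono)
    fix k assume "k \<in> {..<m}"
    have "a k - b k = - (z k - ?u k) / of_real (3 * X)"
      using X by (simp add: a_def b_def field_simps)
    hence "cmod (a k - b k) = cmod (z k - ?u k) / (3 * X)"
      using X by (simp only: norm_divide norm_minus_cancel) simp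
    thus "cmod (a k - b k) \<le> \<eta> / (3 * X)"
      using z[of k] \<open>k \<in> _\<close> X by (simp add: divide_right_mono)
  qed
  also have "\<dots> = real m * \<eta> / (3 * X)" by simp
  \<comment> \<open>The bound on \<open>\<eta>\<close> is tuned to this: undoing the scaling by
    \<open>(3 * X) ^ m\<close> leaves an error of at most \<open>X ^ m\<close>, which together with
    the bound \<open>2 * X ^ m\<close> for the exact nodes gives the constant 3.\<close>
  also have "\<dots> \<le> 1 / 3 ^ m"
  proof -
    have "real m * \<eta> \<le> s / 3 ^ m" using assms(1,3) by (simp add: field_simps)
    also have "\<dots> \<le> X / 3 ^ m" using X by (simp add: divide_right_mono)
    also have "\<dots> \<le> 3 * X / 3 ^ m" using X by (simp add: divide_right_mono)
    finally show ?thesis using X by (simp add: field_simps)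
  qed
  finally have "cmod ((\<Prod>k<m. a k) - (\<Prod>k<m. b k)) * (3 * X) ^ m \<le> X ^ m"
    using X by (simp add: field_simps)
  hence 1: "cmod (((\<Prod>k<m. a k) - (\<Prod>k<m. b k)) * of_real (3 * X) ^ m) \<le> X ^ m"
    using X by (simp add: norm_mult norm_power)
  have "((\<Prod>k<m. a k) - (\<Prod>k<m. b k)) * of_real (3 * X) ^ m
      = (\<Prod>k<m. w - z k) - (\<Prod>k<m. w - ?u k)"
    using X by (simp add: a_def b_def prod_dividef left_diff_distrib)
  with 1 have 2: "cmod ((\<Prod>k<m. w - z k) - (\<Prod>k<m. w - ?u k)) \<le> X ^ m" by simp
  have "cmod (\<Prod>k<m. w - ?u k) \<le> cmod w ^ m + s ^ m"
    unfolding prod_diff_unit_root[OF assms(1,2)]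
    using norm_triangle_ineq4[of "w ^ m" "of_real s ^ m"] assms(2) by (simp add: norm_power)
  also have "\<dots> \<le> X ^ m + X ^ m"
    using X assms(2) by (intro add_mono power_mono) auto
  finally have "cmod (\<Prod>k<m. w - z k) \<le> 3 * X ^ m"
    using 2 norm_triangle_sub[of "\<Prod>k<m. w - z k" "\<Prod>k<m. w - ?u k"] by linarith
  thus ?thesis by (simp add: X_def prod_norm[symmetric] norm_minus_commute)
qed

text \<open>A discrete one-sided Jensen formula. Each zero costs one factor 3 for all
  \<open>m\<close> nodes together, so in the geometric mean of the values the loss is only
  3^(degree/m).\<close>

lemma prod_poly_perturbed_unit_roots_le:
  assumes "m > 0" "s > 0" "\<eta> \<le> s / (real m * 3 ^ m)"
    and z: "\<And>k. k < m \<Longrightarrow> cmod (z k - of_real s * unit_root m k) \<le> \<eta>"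
  shows "(\<Prod>k<m. cmod (poly p (z k))) \<le> 3 ^ degree p * mahler s p ^ m"
proof -
  have *: "(\<Prod>k<m. \<Prod>w\<in>#A. cmod (z k - w)) \<le> 3 ^ size A * (\<Prod>w\<in>#A. max s (cmod w)) ^ m" for A
  proof (induction A)
    case (add w A)
    have "(\<Prod>k<m. \<Prod>w\<in>#add_mset w A. cmod (z k - w))
        = (\<Prod>k<m. cmod (z k - w)) * (\<Prod>k<m. \<Prod>w\<in>#A. cmod (z k - w))"
      by (simp add: prod.distrib)
    also have "\<dots> \<le> (3 * max s (cmod w) ^ m) * (3 ^ size A * (\<Prod>w\<in>#A. max s (cmod w)) ^ m)"
      using add.IH prod_perturbed_unit_roots_le[OF assms] assms(2)
      by (intro mult_mono) (auto intro!: prod_nonneg prod_mset_cmod_nonneg)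
    finally show ?case by (simp add: power_mult_distrib mult_ac)
  qed simp
  have "(\<Prod>k<m. cmod (poly p (z k)))
      = cmod (lead_coeff p) ^ m * (\<Prod>k<m. \<Prod>w\<in>#proots p. cmod (z k - w))"
    by (simp add: norm_poly_eq_prod_proots prod.distrib)
  also have "\<dots> \<le> cmod (lead_coeff p) ^ m * (3 ^ size (proots p) * (\<Prod>w\<in>#proots p. max s (cmod w)) ^ m)"
    by (intro mult_left_mono *) simp
  finally show ?thesis
    by (simp add: size_proots_complex mahler_def power_mult_distrib mult_ac)
qed

section \<open>Zero counts from difference quotients of the logarithmic Mahler measure\<close>

lemma ln_mahler:
  assumes "p \<noteq> 0" "s > 0"
  shows "ln (mahler s p) = ln (cmod (lead_coeff p)) + (\<Sum>z\<in>#proots p. ln (max s (cmod z)))"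
proof -
  note pos = prod_mset_max_pos[OF assms(2)]
  have "ln (\<Prod>z\<in>#A. max s (cmod z)) = (\<Sum>z\<in>#A. ln (max s (cmod z)))" for A
  proof (induction A)
    case (add z A)
    show ?case using add.IH assms(2) pos[of A] by (simp add: ln_mult_pos less_max_iff_disj)
  qed simp
  thus ?thesis using assms pos[of "proots p"] unfolding mahler_def
    by (subst ln_mult_pos) auto
qed

lemma zeros_in_disk_eq_sum_mset:
  "real (zeros_in_disk r p) = (\<Sum>z\<in>#proots p. if cmod z < r then 1 else 0)"
proof -
  have "real (size (filter_mset (\<lambda>z. z \<in> ball 0 r) A)) = (\<Sum>z\<in>#A. if cmod z < r then 1 else 0)" for A
    by (induction A) (auto simp: dist_norm)
  thus ?thesis by (simp add: zeros_in_disk_def)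
qed

lemma sum_mset_diff_real:
  "(\<Sum>z\<in>#A. f z - g z :: real) = (\<Sum>z\<in>#A. f z) - (\<Sum>z\<in>#A. g z)"
  by (induction A) auto

text \<open>Between the radii \<open>r\<close> and \<open>t\<close>, a zero inside the smaller disk
  contributes exactly \<open>ln (t / r)\<close> and every other zero a nonnegative amount.\<close>

lemma zeros_in_disk_le_ln_mahler:
  assumes "p \<noteq> 0" "0 < r" "r < t"
  shows "real (zeros_in_disk r p) * ln (t / r) \<le> ln (mahler t p) - ln (mahler r p)"
proof -
  have "real (zeros_in_disk r p) * ln (t / r)
      = (\<Sum>z\<in>#proots p. (if cmod z < r then 1 else 0) * ln (t / r))"
    unfolding zeros_in_disk_eq_sum_mset by (simp add: sum_mset_distrib_right)
  also have "\<dots> \<le> (\<Sum>z\<in>#proots p. ln (max t (cmod z)) - ln (max r (cmod z)))"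
  proof (rule sum_mset_mono)
    fix z
    have "ln (max r (cmod z)) \<le> ln (max t (cmod z))"
      using assms by (intro ln_mono) auto
    thus "(if cmod z < r then 1 else 0) * ln (t / r) \<le> ln (max t (cmod z)) - ln (max r (cmod z))"
      using assms by (auto simp: ln_div max_def)
  qed
  also have "\<dots> = ln (mahler t p) - ln (mahler r p)"
    using assms by (simp add: ln_mahler sum_mset_diff_real)
  finally show ?thesis .
qed

text \<open>Zeros outside the larger disk contribute nothing to the difference, and each zero inside
  it at most \<open>ln (r / t)\<close>.\<close>

lemma zeros_in_disk_ge_ln_mahler:
  assumes "p \<noteq> 0" "0 < t" "t < r"
  shows "ln (mahler r p) - ln (mahler t p) \<le> real (zeros_in_disk r p) * ln (r / t)"
proof -
  have "ln (mahler r p) - ln (mahler t p)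
      = (\<Sum>z\<in>#proots p. ln (max r (cmod z)) - ln (max t (cmod z)))"
    using assms by (simp add: ln_mahler sum_mset_diff_real)
  also have "\<dots> \<le> (\<Sum>z\<in>#proots p. (if cmod z < r then 1 else 0) * ln (r / t))"
  proof (rule sum_mset_mono)
    fix z
    have "ln t \<le> ln (max t (cmod z))"
      using assms by (intro ln_mono) auto
    thus "ln (max r (cmod z)) - ln (max t (cmod z)) \<le> (if cmod z < r then 1 else 0) * ln (r / t)"
      using assms by (auto simp: ln_div max_def)
  qed
  also have "\<dots> = real (zeros_in_disk r p) * ln (r / t)"
    unfolding zeros_in_disk_eq_sum_mset by (simp add: sum_mset_distrib_right)
  finally show ?thesis .
qed

text \<open>The squeeze is exact when the annulus between \<open>t\<close> and \<open>r\<close> is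
  free of zeros. With \<open>t\<close> increasing to \<open>r\<close> this recovers the count from
  values of \<open>mahler\<close>, which is how measurability is obtained.\<close>

lemma zeros_in_disk_eq_ln_mahler:
  assumes "p \<noteq> 0" "0 < t" "t < r" "\<And>z. poly p z = 0 \<Longrightarrow> cmod z < r \<Longrightarrow> cmod z \<le> t"
  shows "real (zeros_in_disk r p) * ln (r / t) = ln (mahler r p) - ln (mahler t p)"
proof -
  have "ln (mahler r p) - ln (mahler t p)
      = (\<Sum>z\<in>#proots p. ln (max r (cmod z)) - ln (max t (cmod z)))"
    using assms by (simp add: ln_mahler sum_mset_diff_real)
  also have "\<dots> = (\<Sum>z\<in>#proots p. (if cmod z < r then 1 else 0) * ln (r / t))"
    using assms by (intro arg_cong[where f = sum_mset] image_mset_cong)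
      (auto simp: ln_div max_def dest!: assms(4))
  also have "\<dots> = real (zeros_in_disk r p) * ln (r / t)"
    unfolding zeros_in_disk_eq_sum_mset by (simp add: sum_mset_distrib_right)
  finally show ?thesis by simp
qed

section \<open>Measurability of the number of zeros\<close>

text \<open>The quantity under the root lies between two positive constant multiples of
  \<open>X ^ m\<close>, and \<open>m\<close>-th roots of constants tend to 1. Having
  \<open>cmod w\<close> different from \<open>s\<close> keeps the lower constant
  \<open>1 - q\<close> positive.\<close>

lemma tendsto_root_norm_diff_power:
  fixes s :: real and w :: complex
  assumes "s > 0" "cmod w \<noteq> s"
  shows "(\<lambda>m. root m (cmod (w ^ m - of_real s ^ m))) \<longlonglongrightarrow> max s (cmod w)"
proof -
  define X where "X = max s (cmod w)"
  define q where "q = min s (cmod w) / X"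
  have X: "X > 0" "s \<le> X" "cmod w \<le> X" using assms by (auto simp: X_def)
  have "min s (cmod w) < X" using assms by (auto simp: X_def min_def max_def)
  hence q: "0 \<le> q" "q < 1" using assms X by (auto simp: q_def)
  have lower: "X ^ m * (1 - q) \<le> cmod (w ^ m - of_real s ^ m)" if "m > 0" for m
  proof -
    have "q ^ m \<le> q ^ 1" using q that by (intro power_decreasing) auto
    hence "X ^ m * (1 - q) \<le> X ^ m * (1 - q ^ m)" using X by (intro mult_left_mono) auto
    also have "\<dots> = X ^ m - (min s (cmod w)) ^ m"
      using X by (simp add: q_def power_divide right_diff_distrib)
    also have "\<dots> \<le> \<bar>cmod w ^ m - s ^ m\<bar>"
      by (auto simp: X_def min_def max_def)
    also have "\<dots> = \<bar>cmod (w ^ m) - cmod (of_real s ^ m)\<bar>"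
      using assms(1) by (simp add: norm_power)
    also have "\<dots> \<le> cmod (w ^ m - of_real s ^ m)" by (rule norm_triangle_ineq3)
    finally show ?thesis .
  qed
  have upper: "cmod (w ^ m - of_real s ^ m) \<le> X ^ m * 2" for m
  proof -
    have "cmod (w ^ m - of_real s ^ m) \<le> cmod w ^ m + s ^ m"
      using norm_triangle_ineq4[of "w ^ m" "of_real s ^ m"] assms(1) by (simp add: norm_power)
    also have "\<dots> \<le> X ^ m + X ^ m"
      using X assms(1) by (intro add_mono power_mono) auto
    finally show ?thesis by simp
  qed
  have lim: "(\<lambda>m. X * root m c) \<longlonglongrightarrow> X" if "c > 0" for c
    using tendsto_mult[OF tendsto_const[of X] LIMSEQ_root_const[OF that]] by simp
  have root: "root m (X ^ m * c) = X * root m c" if "m > 0" for m c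
    using that X by (simp add: real_root_mult real_root_power_cancel)
  show ?thesis unfolding X_def[symmetric]
  proof (rule tendsto_sandwich[OF _ _ lim lim])
    show "eventually (\<lambda>m. X * root m (1 - q) \<le> root m (cmod (w ^ m - of_real s ^ m))) sequentially"
      using eventually_gt_at_top[of 0]
    proof eventually_elim
      case (elim m)
      thus ?case using real_root_le_mono[OF elim lower[OF elim]] by (simp add: root)
    qed
    show "eventually (\<lambda>m. root m (cmod (w ^ m - of_real s ^ m)) \<le> X * root m 2) sequentially"
      using eventually_gt_at_top[of 0]
    proof eventually_elim
      case (elim m)
      thus ?case using real_root_le_mono[OF elim upper[of m]] by (simp add: root)
    qed
  qed (use q in auto)
qed

text \<open>Zero by zero, the product over the nodes collapses to |w^m - s^m|. Thus
  \<open>mahler\<close> is a limit of functions of finitely many values of \<open>p\<close>, which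
  makes it accessible to measurability.\<close>

lemma tendsto_root_prod_unit_roots_mahler:
  assumes "s > 0" "\<And>z. poly p z = 0 \<Longrightarrow> cmod z \<noteq> s" "p \<noteq> 0"
  shows "(\<lambda>m. root m (\<Prod>k<m. cmod (poly p (of_real s * unit_root m k)))) \<longlonglongrightarrow> mahler s p"
proof -
  have lim: "(\<lambda>m. root m (\<Prod>w\<in>#A. cmod (w ^ m - of_real s ^ m))) \<longlonglongrightarrow> (\<Prod>w\<in>#A. max s (cmod w))"
    if "\<And>w. w \<in># A \<Longrightarrow> cmod w \<noteq> s" for A
    using that
  proof (induction A)
    case empty
    show ?case by (simp add: LIMSEQ_root_const)
  next
    case (add w A)
    show ?case using add by (simp add: real_root_mult tendsto_mult tendsto_root_norm_diff_power assms(1))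
  qed
  have eq: "(\<Prod>k<m. cmod (poly p (of_real s * unit_root m k)))
      = cmod (lead_coeff p) ^ m * (\<Prod>w\<in>#proots p. cmod (w ^ m - of_real s ^ m))" if "m > 0" for m
  proof -
    have "(\<Prod>k<m. \<Prod>w\<in>#A. cmod (of_real s * unit_root m k - w))
        = (\<Prod>w\<in>#A. cmod (w ^ m - of_real s ^ m))" for A
    proof (induction A)
      case (add w A)
      have "(\<Prod>k<m. cmod (of_real s * unit_root m k - w)) = cmod (w ^ m - of_real s ^ m)"
        using prod_diff_unit_root[OF that assms(1), of w]
        by (simp add: prod_norm norm_minus_commute)
      thus ?case using add.IH by (simp add: prod.distrib)
    qed simp
    thus ?thesis by (simp add: norm_poly_eq_prod_proots prod.distrib)
  qed
  have "(\<lambda>m. cmod (lead_coeff p) * root m (\<Prod>w\<in>#proots p. cmod (w ^ m - of_real s ^ m)))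
      \<longlonglongrightarrow> mahler s p"
    unfolding mahler_def using assms by (intro tendsto_mult tendsto_const lim) auto
  moreover have "eventually (\<lambda>m. root m (\<Prod>k<m. cmod (poly p (of_real s * unit_root m k)))
      = cmod (lead_coeff p) * root m (\<Prod>w\<in>#proots p. cmod (w ^ m - of_real s ^ m))) sequentially"
    using eventually_gt_at_top[of 0]
    by eventually_elim (simp add: eq real_root_mult real_root_power_cancel)
  ultimately show ?thesis by (simp add: tendsto_cong)
qed

lemma tendsto_mahler:
  assumes "(f \<longlongrightarrow> s) F"
  shows "((\<lambda>x. mahler (f x) p) \<longlongrightarrow> mahler s p) F"
proof -
  have "((\<lambda>x. \<Prod>z\<in>#A. max (f x) (cmod z)) \<longlongrightarrow> (\<Prod>z\<in>#A. max s (cmod z))) F" for A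
    by (induction A) (auto intro!: tendsto_intros assms)
  thus ?thesis unfolding mahler_def by (intro tendsto_intros)
qed

text \<open>No measurable choice of the zeros is made: \<open>mahler\<close> is an iterated limit of
  functions of point values, and the count is a limit of difference quotients of its
  logarithm.\<close>

lemma measurable_zeros_in_disk:
  fixes P :: "'a \<Rightarrow> complex poly"
  assumes r: "r > 0"
    and P[measurable]: "\<And>z. (\<lambda>\<omega>. poly (P \<omega>) z) \<in> borel_measurable M"
    and Z[measurable]: "{\<omega> \<in> space M. P \<omega> = 0} \<in> sets M"
  shows "(\<lambda>\<omega>. real (zeros_in_disk r (P \<omega>))) \<in> borel_measurable M"
proof -
  \<comment> \<open>The inner limit is known to be \<open>mahler\<close> only on circles free of
    zeros. The radii s + 1/(n+1) meet the finitely many zero moduli for only finitely many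
    \<open>n\<close>, and the outer limit returns to \<open>s\<close> by continuity.\<close>
  define f where "f s \<omega> = lim (\<lambda>n. lim (\<lambda>m. root m
    (\<Prod>k<m. cmod (poly (P \<omega>) (of_real (s + 1 / real (Suc n)) * unit_root m k)))))" for s \<omega>
  have root_meas: "(\<lambda>\<omega>. root m (g \<omega>)) \<in> borel_measurable M" if "g \<in> borel_measurable M" for m g
    by (rule measurable_compose[OF that borel_measurable_continuous_onI])
       (intro continuous_intros)
  have f[measurable]: "f s \<in> borel_measurable M" for s
    unfolding f_def by (intro borel_measurable_lim_metric root_meas) measurable
  have f_eq: "f s \<omega> = mahler s (P \<omega>)" if "P \<omega> \<noteq> 0" "s > 0" for s \<omega>
  proof -
    have lim_s: "(\<lambda>n. s + 1 / real (Suc n)) \<longlonglongrightarrow> s"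
      using tendsto_add[OF tendsto_const[of s] LIMSEQ_Suc[OF lim_1_over_n]] by simp
    have "eventually (\<lambda>n. \<forall>z\<in>{z. poly (P \<omega>) z = 0}. cmod z \<noteq> s + 1 / real (Suc n)) sequentially"
    proof (rule eventually_ball_finite)
      show "\<forall>z\<in>{z. poly (P \<omega>) z = 0}. eventually (\<lambda>n. cmod z \<noteq> s + 1 / real (Suc n)) sequentially"
      proof
        fix z
        show "eventually (\<lambda>n. cmod z \<noteq> s + 1 / real (Suc n)) sequentially"
        proof (cases "cmod z \<le> s")
          case True
          have "cmod z < s + 1 / real (Suc n)" for n
            using True by (rule le_less_trans) simp
          thus ?thesis by (intro always_eventually) (metis less_irrefl)
        next
          case False
          hence "eventually (\<lambda>n. s + 1 / real (Suc n) < cmod z) sequentially"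
            using order_tendstoD(2)[OF lim_s, of "cmod z"] by simp
          thus ?thesis by eventually_elim simp
        qed
      qed
    qed (simp add: poly_roots_finite that)
    hence ev: "eventually (\<lambda>n. mahler (s + 1 / real (Suc n)) (P \<omega>) = lim (\<lambda>m. root m
      (\<Prod>k<m. cmod (poly (P \<omega>) (of_real (s + 1 / real (Suc n)) * unit_root m k))))) sequentially"
    proof eventually_elim
      case (elim n)
      have "s + 1 / real (Suc n) > 0" using that(2) by (simp add: add_pos_pos)
      thus ?case using elim that(1)
        by (intro limI[symmetric] tendsto_root_prod_unit_roots_mahler) auto
    qed
    have "(\<lambda>n. mahler (s + 1 / real (Suc n)) (P \<omega>)) \<longlonglongrightarrow> mahler s (P \<omega>)"
      by (rule tendsto_mahler[OF lim_s])
    hence "(\<lambda>n. lim (\<lambda>m. root m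
      (\<Prod>k<m. cmod (poly (P \<omega>) (of_real (s + 1 / real (Suc n)) * unit_root m k))))) \<longlonglongrightarrow> mahler s (P \<omega>)"
      by (rule Lim_transform_eventually[OF _ ev])
    thus ?thesis unfolding f_def by (rule limI)
  qed
  \<comment> \<open>Dividing by n + 2 rather than n + 1 keeps \<open>t 0\<close> positive.\<close>
  define t where "t n = r - r / real (Suc (Suc n))" for n
  have t: "0 < t n" "t n < r" for n
    using r by (auto simp: t_def field_simps intro!: add_pos_nonneg)
  have t_lim: "t \<longlonglongrightarrow> r"
  proof -
    have "(\<lambda>n. r - r * (1 / real (Suc (Suc n)))) \<longlonglongrightarrow> r - r * 0"
      by (intro tendsto_intros LIMSEQ_Suc[OF LIMSEQ_Suc[OF lim_1_over_n]])
    thus ?thesis by (simp add: t_def[abs_def])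
  qed
  \<comment> \<open>The zero polynomial has an empty multiset of zeros, hence count 0. Otherwise the
    quotient is eventually constant, because \<open>t n\<close> passes the moduli of all zeros in
    the open disk.\<close>
  have count: "real (zeros_in_disk r (P \<omega>)) =
    (if P \<omega> = 0 then 0 else lim (\<lambda>n. (ln (f r \<omega>) - ln (f (t n) \<omega>)) / ln (r / t n)))" for \<omega>
  proof (cases "P \<omega> = 0")
    case True
    thus ?thesis by (simp add: zeros_in_disk_def)
  next
    case False
    have "eventually (\<lambda>n. \<forall>z\<in>{z. poly (P \<omega>) z = 0}. cmod z < r \<longrightarrow> cmod z \<le> t n) sequentially"
    proof (rule eventually_ball_finite)
      show "\<forall>z\<in>{z. poly (P \<omega>) z = 0}. eventually (\<lambda>n. cmod z < r \<longrightarrow> cmod z \<le> t n) sequentially"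
      proof
        fix z
        show "eventually (\<lambda>n. cmod z < r \<longrightarrow> cmod z \<le> t n) sequentially"
        proof (cases "cmod z < r")
          case True
          from order_tendstoD(1)[OF t_lim True] show ?thesis by eventually_elim simp
        qed simp
      qed
    qed (simp add: poly_roots_finite False)
    hence ev: "eventually (\<lambda>n. real (zeros_in_disk r (P \<omega>)) =
      (ln (f r \<omega>) - ln (f (t n) \<omega>)) / ln (r / t n)) sequentially"
    proof eventually_elim
      case (elim n)
      have "real (zeros_in_disk r (P \<omega>)) * ln (r / t n)
          = ln (mahler r (P \<omega>)) - ln (mahler (t n) (P \<omega>))"
        using elim t[of n] False by (intro zeros_in_disk_eq_ln_mahler) auto
      moreover have "ln (r / t n) > 0" using t[of n] by simp
      ultimately show ?case using t[of n] r False by (simp add: f_eq field_simps)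
    qed
    have "(\<lambda>n. (ln (f r \<omega>) - ln (f (t n) \<omega>)) / ln (r / t n)) \<longlonglongrightarrow> real (zeros_in_disk r (P \<omega>))"
      by (rule Lim_transform_eventually[OF tendsto_const ev])
    thus ?thesis using False by (simp add: limI)
  qed
  show ?thesis unfolding count
    by (intro measurable_If borel_measurable_lim_metric Z) measurable
qed

section \<open>Small balls and tails for complex Gaussians\<close>

lemma emeasure_lborel_cball_complex:
  "\<epsilon> \<ge> 0 \<Longrightarrow> emeasure lborel (cball (c::complex) \<epsilon>) = ennreal (pi * \<epsilon>\<^sup>2)"
  by (simp add: emeasure_cball unit_ball_vol_2)

lemma std_complex_gaussian_measurable:
  "std_complex_gaussian M X \<Longrightarrow> X \<in> borel_measurable M"
  by (simp add: std_complex_gaussian_def distributed_def)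

text \<open>The event says that the variable falls into a disk of radius
  \<open>\<epsilon> / cmod c\<close>, wherever \<open>w\<close> puts its center, and the density is
  at most \<open>1 / pi\<close>.\<close>

lemma std_complex_gaussian_affine_small:
  assumes "std_complex_gaussian M X" "c \<noteq> 0" "\<epsilon> \<ge> 0"
  shows "emeasure (distr M borel X) {x. cmod (c * x + w) \<le> \<epsilon>} \<le> ennreal ((\<epsilon> / cmod c)\<^sup>2)"
proof -
  have eq: "{x. cmod (c * x + w) \<le> \<epsilon>} = cball (- w / c) (\<epsilon> / cmod c)"
  proof (intro set_eqI)
    fix x
    have "cmod (c * x + w) = cmod c * cmod (x - (- w / c))"
      using assms(2) by (simp add: norm_mult[symmetric] distrib_left)
    moreover have "x \<in> cball a e \<longleftrightarrow> cmod (x - a) \<le> e" for a e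
      by (simp add: dist_norm norm_minus_commute)
    ultimately show "x \<in> {x. cmod (c * x + w) \<le> \<epsilon>} \<longleftrightarrow> x \<in> cball (- w / c) (\<epsilon> / cmod c)"
      using assms(2) by (simp only: mem_Collect_eq) (simp add: pos_le_divide_eq mult.commute)
  qed
  have D: "distr M lborel X = density lborel (\<lambda>w. ennreal (exp (- (cmod w)\<^sup>2) / pi))"
    using assms(1) by (simp add: std_complex_gaussian_def distributed_def)
  have "distr M borel X = distr M lborel X"
    by (rule distr_cong) auto
  hence "emeasure (distr M borel X) {x. cmod (c * x + w) \<le> \<epsilon>}
      = (\<integral>\<^sup>+x. ennreal (exp (- (cmod x)\<^sup>2) / pi) * indicator (cball (- w / c) (\<epsilon> / cmod c)) x \<partial>lborel)"
    unfolding eq D by (subst emeasure_density[symmetric]) auto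
  also have "\<dots> \<le> (\<integral>\<^sup>+x. ennreal (1 / pi) * indicator (cball (- w / c) (\<epsilon> / cmod c)) x \<partial>lborel)"
    by (intro nn_integral_mono mult_right_mono ennreal_leI divide_right_mono) auto
  also have "\<dots> = ennreal (1 / pi) * ennreal (pi * (\<epsilon> / cmod c)\<^sup>2)"
    using assms(3) by (subst nn_integral_cmult_indicator) (auto simp: emeasure_lborel_cball_complex)
  also have "\<dots> = ennreal ((\<epsilon> / cmod c)\<^sup>2)"
    by (subst ennreal_mult[symmetric]) auto
  finally show ?thesis .
qed

text \<open>Rescaling the Gaussian density by \<open>sqrt 2\<close> shows that the expectation of \<open>exp (\<bar>X\<bar>\<^sup>2 / 2)\<close>
  is 2; the bound is then Markov's inequality.\<close>

lemma (in prob_space) std_complex_gaussian_tail: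
  assumes "std_complex_gaussian M X" "t \<ge> 0"
  shows "prob {\<omega> \<in> space M. t \<le> cmod (X \<omega>)} \<le> 2 * exp (- t\<^sup>2 / 2)"
proof -
  define f where "f w = ennreal (exp (- (cmod w)\<^sup>2) / pi)" for w :: complex
  have dist: "distributed M lborel X f"
    using assms(1) unfolding std_complex_gaussian_def f_def .
  have [measurable]: "f \<in> borel_measurable borel" unfolding f_def by measurable
  have X[measurable]: "X \<in> borel_measurable M"
    using assms(1) by (rule std_complex_gaussian_measurable)
  \<comment> \<open>The normalisation of the density is read off from the total mass 1 of the
    probability space.\<close>
  have one: "(\<integral>\<^sup>+w. f w \<partial>lborel) = 1"
    using distributed_nn_integral[OF dist, of "\<lambda>_. 1"] by (simp add: emeasure_space_1)
  have "(\<integral>\<^sup>+\<omega>. ennreal (exp ((cmod (X \<omega>))\<^sup>2 / 2)) \<partial>M)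
      = (\<integral>\<^sup>+w. f w * ennreal (exp ((cmod w)\<^sup>2 / 2)) \<partial>lborel)"
    by (rule distributed_nn_integral[OF dist, symmetric]) measurable
  also have "\<dots> = (\<integral>\<^sup>+w. f (w /\<^sub>R sqrt 2) \<partial>lborel)"
  proof (intro nn_integral_cong)
    fix w :: complex
    have "exp (- (cmod w)\<^sup>2) / pi * exp ((cmod w)\<^sup>2 / 2) = exp (- (cmod (w /\<^sub>R sqrt 2))\<^sup>2) / pi"
      by (simp add: exp_add[symmetric] power_divide field_simps)
    thus "f w * ennreal (exp ((cmod w)\<^sup>2 / 2)) = f (w /\<^sub>R sqrt 2)"
      unfolding f_def by (subst ennreal_mult[symmetric]) auto
  qed
  \<comment> \<open>Dilation by \<open>sqrt 2\<close> in two real dimensions has Jacobian 2.\<close>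
  also have "\<dots> = (\<integral>\<^sup>+w. 2 * f w \<partial>lborel)"
    by (subst lborel_affine[of "sqrt 2" 0])
       (simp_all add: nn_integral_density nn_integral_distr)
  also have "\<dots> = 2"
    by (subst nn_integral_cmult) (auto simp: one)
  finally have E: "(\<integral>\<^sup>+\<omega>. ennreal (exp ((cmod (X \<omega>))\<^sup>2 / 2)) \<partial>M) = 2" .
  have "emeasure M {\<omega> \<in> space M. 1 \<le> ennreal (exp (- t\<^sup>2 / 2)) * ennreal (exp ((cmod (X \<omega>))\<^sup>2 / 2))}
      \<le> ennreal (exp (- t\<^sup>2 / 2)) * (\<integral>\<^sup>+\<omega>. ennreal (exp ((cmod (X \<omega>))\<^sup>2 / 2)) * indicator (space M) \<omega> \<partial>M)"
    by (rule nn_integral_Markov_inequality) auto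
  also have "(\<integral>\<^sup>+\<omega>. ennreal (exp ((cmod (X \<omega>))\<^sup>2 / 2)) * indicator (space M) \<omega> \<partial>M) = 2"
    unfolding E[symmetric] by (intro nn_integral_cong) auto
  also have "{\<omega> \<in> space M. 1 \<le> ennreal (exp (- t\<^sup>2 / 2)) * ennreal (exp ((cmod (X \<omega>))\<^sup>2 / 2))}
      = {\<omega> \<in> space M. t \<le> cmod (X \<omega>)}"
  proof (intro Collect_cong conj_cong refl)
    fix \<omega>
    have "1 \<le> ennreal (exp (- t\<^sup>2 / 2)) * ennreal (exp ((cmod (X \<omega>))\<^sup>2 / 2)) \<longleftrightarrow>
          1 \<le> exp (- t\<^sup>2 / 2 + (cmod (X \<omega>))\<^sup>2 / 2)"
      by (subst ennreal_mult[symmetric]) (auto simp: exp_add[symmetric])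
    also have "\<dots> \<longleftrightarrow> t\<^sup>2 \<le> (cmod (X \<omega>))\<^sup>2" by (simp add: field_simps)
    also have "\<dots> \<longleftrightarrow> t \<le> cmod (X \<omega>)"
      using assms(2) by (simp add: abs_le_square_iff[symmetric])
    finally show "1 \<le> ennreal (exp (- t\<^sup>2 / 2)) * ennreal (exp ((cmod (X \<omega>))\<^sup>2 / 2)) \<longleftrightarrow>
      t \<le> cmod (X \<omega>)" .
  qed
  also have "ennreal (exp (- t\<^sup>2 / 2)) * 2 = ennreal (2 * exp (- t\<^sup>2 / 2))"
    by (subst mult.commute) (simp add: ennreal_mult')
  finally show ?thesis
    by (simp add: emeasure_eq_measure)
qed

lemma (in prob_space) indep_std_complex_gaussian_affine_small:
  assumes X: "std_complex_gaussian M (\<lambda>\<omega>. h (U \<omega>))" and ind: "indep_var T U S V"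
    and h[measurable]: "h \<in> borel_measurable T"
    and c: "c \<noteq> 0" and eps: "\<epsilon> \<ge> 0"
    and W[measurable]: "W \<in> borel_measurable S" and B[measurable]: "B \<in> sets S"
  shows "prob {\<omega> \<in> space M. V \<omega> \<in> B \<and> cmod (c * h (U \<omega>) + W (V \<omega>)) \<le> \<epsilon>}
    \<le> (\<epsilon> / cmod c)\<^sup>2 * prob {\<omega> \<in> space M. V \<omega> \<in> B}"
proof -
  have rv[measurable]: "U \<in> measurable M T" "V \<in> measurable M S"
    and eq: "distr M T U \<Otimes>\<^sub>M distr M S V = distr M (T \<Otimes>\<^sub>M S) (\<lambda>x. (U x, V x))"
    using ind unfolding indep_var_distribution_eq by auto
  interpret U: prob_space "distr M T U" by (rule prob_space_distr) fact
  interpret V: prob_space "distr M S V" by (rule prob_space_distr) fact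
  interpret UV: pair_prob_space "distr M T U" "distr M S V" ..
  define A where "A = {p \<in> space (T \<Otimes>\<^sub>M S). snd p \<in> B \<and> cmod (c * h (fst p) + W (snd p)) \<le> \<epsilon>}"
  have A[measurable]: "A \<in> sets (T \<Otimes>\<^sub>M S)" unfolding A_def by measurable
  have "emeasure M {\<omega> \<in> space M. V \<omega> \<in> B \<and> cmod (c * h (U \<omega>) + W (V \<omega>)) \<le> \<epsilon>}
      = emeasure (distr M (T \<Otimes>\<^sub>M S) (\<lambda>x. (U x, V x))) A"
    using measurable_space[OF rv(1)] measurable_space[OF rv(2)]
    by (subst emeasure_distr) (auto intro!: arg_cong2[where f = emeasure] simp: A_def space_pair_measure)
  also have "\<dots> = (\<integral>\<^sup>+v. emeasure (distr M T U) ((\<lambda>x. (x, v)) -` A) \<partial>distr M S V)"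
    unfolding eq[symmetric]
    by (rule UV.emeasure_pair_measure_alt2) (use A in \<open>simp cong: sets_pair_measure_cong\<close>)
  also have "\<dots> \<le> (\<integral>\<^sup>+v. ennreal ((\<epsilon> / cmod c)\<^sup>2) * indicator B v \<partial>distr M S V)"
  proof (rule nn_integral_mono)
    fix v assume v: "v \<in> space (distr M S V)"
    show "emeasure (distr M T U) ((\<lambda>x. (x, v)) -` A) \<le> ennreal ((\<epsilon> / cmod c)\<^sup>2) * indicator B v"
    proof (cases "v \<in> B")
      case True
      hence "(\<lambda>x. (x, v)) -` A = h -` {x. cmod (c * x + W v) \<le> \<epsilon>} \<inter> space T"
        using v by (auto simp: A_def space_pair_measure)
      hence "emeasure (distr M T U) ((\<lambda>x. (x, v)) -` A)
          = emeasure (distr (distr M T U) borel h) {x. cmod (c * x + W v) \<le> \<epsilon>}"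
        by (simp add: emeasure_distr)
      also have "distr (distr M T U) borel h = distr M borel (\<lambda>\<omega>. h (U \<omega>))"
        by (simp add: distr_distr o_def)
      finally show ?thesis
        using std_complex_gaussian_affine_small[OF X c eps, of "W v"] True by simp
    qed (auto simp: A_def vimage_def)
  qed
  also have "\<dots> = ennreal ((\<epsilon> / cmod c)\<^sup>2) * emeasure (distr M S V) B"
    by (subst nn_integral_cmult_indicator) auto
  also have "emeasure (distr M S V) B = emeasure M {\<omega> \<in> space M. V \<omega> \<in> B}"
    by (subst emeasure_distr) (auto intro!: arg_cong2[where f = emeasure])
  finally show ?thesis
    by (simp add: emeasure_eq_measure ennreal_mult[symmetric])
qed

text \<open>The variable \<open>\<alpha> (j0 + k)\<close> enters row \<open>k\<close> with a nonzero
  coefficient and no later row. Given the other variables, it makes row \<open>k\<close> small with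
  probability at most the \<open>k\<close>-th factor; coefficients outside the block only move the
  center of a disk.\<close>

lemma (in prob_space) triangular_gaussian_small_ball:
  fixes c :: "nat \<Rightarrow> nat \<Rightarrow> complex"
  assumes ind: "indep_vars (\<lambda>_. borel) \<alpha> {..N}"
    and gauss: "\<And>j. j \<le> N \<Longrightarrow> std_complex_gaussian M (\<alpha> j)"
    and range: "j0 + n \<le> Suc N"
    and zero: "\<And>i l. l < i \<Longrightarrow> i < n \<Longrightarrow> c i (j0 + l) = 0"
    and diag: "\<And>i. i < n \<Longrightarrow> c i (j0 + i) \<noteq> 0"
    and eps: "\<And>i. i < n \<Longrightarrow> 0 \<le> \<epsilon> i"
  shows "prob {\<omega> \<in> space M. \<forall>i<n. cmod (\<Sum>j\<le>N. c i j * \<alpha> j \<omega>) \<le> \<epsilon> i}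
    \<le> (\<Prod>i<n. (\<epsilon> i / cmod (c i (j0 + i)))\<^sup>2)"
proof -
  have rv[measurable]: "\<alpha> j \<in> borel_measurable M" if "j \<le> N" for j
    using gauss[OF that] by (rule std_complex_gaussian_measurable)
  \<comment> \<open>Only the rows from \<open>k\<close> on are kept, so the descending induction
    starts at \<open>k = n\<close> with the empty product and ends at 0 with all rows.\<close>
  define E where "E k = {\<omega> \<in> space M. \<forall>i\<in>{k..<n}. cmod (\<Sum>j\<le>N. c i j * \<alpha> j \<omega>) \<le> \<epsilon> i}" for k
  have "prob (E k) \<le> (\<Prod>i\<in>{k..<n}. (\<epsilon> i / cmod (c i (j0 + i)))\<^sup>2)" if "k \<le> n" for k
    using that
  proof (induction k rule: inc_induct)
    case base
    show ?case by simp
  next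
    case (step k)
    \<comment> \<open>The earlier block indices are removed as well, since their coefficients vanish
      in the rows from \<open>k\<close> on. The only variable outside \<open>J\<close> in these rows
      is \<open>\<alpha> (j0 + k)\<close>.\<close>
    define J where "J = {..N} - {j0..j0+k}"
    define V where "V \<omega> = restrict (\<lambda>j. \<alpha> j \<omega>) J" for \<omega>
    define S where "S = Pi\<^sub>M J (\<lambda>_. borel :: complex measure)"
    define Y where "Y i v = (\<Sum>j\<in>J. c i j * v j)" for i and v :: "nat \<Rightarrow> complex"
    define B where "B = {v \<in> space S. \<forall>i\<in>{Suc k..<n}. cmod (Y i v) \<le> \<epsilon> i}"
    have Y[measurable]: "Y i \<in> borel_measurable S" for i
      unfolding Y_def S_def by measurable
    have B: "B \<in> sets S" unfolding B_def by measurable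
    have V: "V \<omega> \<in> space S" for \<omega>
      by (auto simp: V_def S_def space_PiM)
    have sum: "(\<Sum>j\<le>N. c i j * \<alpha> j \<omega>) = c i (j0 + k) * \<alpha> (j0 + k) \<omega> + Y i (V \<omega>)"
      if "k \<le> i" "i < n" for i \<omega>
    proof -
      have "(\<Sum>j\<le>N. c i j * \<alpha> j \<omega>) = (\<Sum>j\<in>insert (j0+k) J. c i j * \<alpha> j \<omega>)"
      proof (rule sum.mono_neutral_right)
        show "insert (j0+k) J \<subseteq> {..N}" using that range by (auto simp: J_def)
        show "\<forall>j\<in>{..N} - insert (j0+k) J. c i j * \<alpha> j \<omega> = 0"
        proof
          fix j assume "j \<in> {..N} - insert (j0+k) J"
          hence "j - j0 < k" "j = j0 + (j - j0)" by (auto simp: J_def)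
          thus "c i j * \<alpha> j \<omega> = 0" using zero[of "j - j0" i] that by auto
        qed
      qed simp
      also have "\<dots> = c i (j0+k) * \<alpha> (j0+k) \<omega> + (\<Sum>j\<in>J. c i j * \<alpha> j \<omega>)"
        by (subst sum.insert) (auto simp: J_def)
      also have "(\<Sum>j\<in>J. c i j * \<alpha> j \<omega>) = Y i (V \<omega>)"
        by (simp add: Y_def V_def)
      finally show ?thesis .
    qed
    have ind': "indep_var (Pi\<^sub>M {j0+k} (\<lambda>_. borel)) (\<lambda>\<omega>. restrict (\<lambda>j. \<alpha> j \<omega>) {j0+k}) S V"
      unfolding S_def V_def using ind step.hyps range
      by (intro indep_var_restrict[of _ _ "{..N}"]) (auto simp: J_def)
    have "E k = {\<omega> \<in> space M. V \<omega> \<in> B \<and> cmod (c k (j0+k) * \<alpha> (j0+k) \<omega> + Y k (V \<omega>)) \<le> \<epsilon> k}"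
    proof (intro set_eqI)
      fix \<omega>
      \<comment> \<open>Rows after \<open>k\<close> also have coefficient 0 at
        \<open>j0 + k\<close>, so they depend on \<open>V\<close> alone.\<close>
      have 1: "(\<Sum>j\<le>N. c i j * \<alpha> j \<omega>) = Y i (V \<omega>)" if "i \<in> {Suc k..<n}" for i
        using sum[of i \<omega>] zero[of k i] that by auto
      have "{k..<n} = insert k {Suc k..<n}" using step.hyps by auto
      thus "\<omega> \<in> E k \<longleftrightarrow> \<omega> \<in> {\<omega> \<in> space M. V \<omega> \<in> B \<and>
          cmod (c k (j0+k) * \<alpha> (j0+k) \<omega> + Y k (V \<omega>)) \<le> \<epsilon> k}"
        using 1 sum[of k \<omega>] step.hyps V[of \<omega>] by (auto simp: E_def B_def)
    qed
    hence "prob (E k) \<le> (\<epsilon> k / cmod (c k (j0+k)))\<^sup>2 * prob {\<omega> \<in> space M. V \<omega> \<in> B}"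
      using indep_std_complex_gaussian_affine_small[OF _ ind' _ diag eps Y B, of "\<lambda>f. f (j0+k)" k k k]
        gauss[of "j0+k"] step.hyps range by simp
    also have "{\<omega> \<in> space M. V \<omega> \<in> B} = E (Suc k)"
    proof (intro set_eqI)
      fix \<omega>
      have 1: "(\<Sum>j\<le>N. c i j * \<alpha> j \<omega>) = Y i (V \<omega>)" if "i \<in> {Suc k..<n}" for i
        using sum[of i \<omega>] zero[of k i] that by auto
      show "\<omega> \<in> {\<omega> \<in> space M. V \<omega> \<in> B} \<longleftrightarrow> \<omega> \<in> E (Suc k)"
        using 1 V[of \<omega>] by (auto simp: E_def B_def)
    qed
    also have "(\<epsilon> k / cmod (c k (j0+k)))\<^sup>2 * prob (E (Suc k))
        \<le> (\<epsilon> k / cmod (c k (j0+k)))\<^sup>2 * (\<Prod>i\<in>{Suc k..<n}. (\<epsilon> i / cmod (c i (j0 + i)))\<^sup>2)"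
      by (intro mult_left_mono step.IH) simp
    also have "\<dots> = (\<Prod>i\<in>{k..<n}. (\<epsilon> i / cmod (c i (j0 + i)))\<^sup>2)"
      using step.hyps by (subst prod.atLeast_Suc_lessThan[of k n]) auto
    finally show ?case .
  qed
  from this[of 0] show ?thesis by (simp add: E_def atLeast0LessThan Ball_def)
qed

section \<open>Exponentially small values of SU(2) polynomials\<close>

text \<open>A discrete Cauchy formula for the \<open>i\<close>-th Taylor coefficient at
  \<open>\<zeta>\<close>. After binomial expansion orthogonality keeps only the exponent
  \<open>a = i\<close>, with \<open>i < n\<close> excluding aliasing; as a <= l <= i, this term
  occurs only for \<open>l = i\<close>, with binomial coefficient 1.\<close>

lemma sum_shifted_unit_roots:
  fixes \<zeta> :: complex and \<eta> :: real
  assumes "l \<le> i" "i < n" "\<eta> \<noteq> 0"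
  shows "(\<Sum>k<n. (\<zeta> + of_real \<eta> * unit_root n k) ^ l / (of_real \<eta> * unit_root n k) ^ i)
    = (if l = i then of_nat n else 0)"
proof -
  have "(\<Sum>k<n. (\<zeta> + of_real \<eta> * unit_root n k) ^ l / (of_real \<eta> * unit_root n k) ^ i)
    = (\<Sum>k<n. \<Sum>a\<le>l. of_nat (l choose a) * \<zeta> ^ (l - a) * of_real \<eta> ^ a / of_real \<eta> ^ i *
        (unit_root n k ^ a / unit_root n k ^ i))"
    by (intro sum.cong refl, subst add.commute, subst binomial_ring)
       (simp add: sum_divide_distrib power_mult_distrib mult_ac)
  also have "\<dots> = (\<Sum>a\<le>l. of_nat (l choose a) * \<zeta> ^ (l - a) * of_real \<eta> ^ a / of_real \<eta> ^ i *
        (\<Sum>k<n. unit_root n k ^ a / unit_root n k ^ i))"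
    by (subst sum.swap) (simp only: sum_distrib_left)
  also have "\<dots> = (\<Sum>a\<le>l. of_nat (l choose a) * \<zeta> ^ (l - a) * of_real \<eta> ^ a / of_real \<eta> ^ i *
        (if a = i then of_nat n else 0))"
    using assms by (intro sum.cong refl) (subst sum_unit_root_power_quotient, auto)
  also have "\<dots> = (\<Sum>a\<le>l. if a = i then (if l = i then of_nat n else 0) else 0)"
    using assms by (intro sum.cong refl) auto
  also have "\<dots> = (if l = i then of_nat n else 0)"
    using assms by (cases "l = i") auto
  finally show ?thesis .
qed

text \<open>The functionals \<open>f \<mapsto> (1/n) \<Sum>\<^sub>k f(z\<^sub>k) z\<^sub>k\<^bsup>-j0\<^esup> (z\<^sub>k - \<zeta>)\<^bsup>-i\<^esup>\<close> are discrete Taylor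
  coefficients of \<open>f(z) z\<^bsup>-j0\<^esup>\<close> at \<open>\<zeta>\<close>. They are triangular on the block \<open>z\<^bsup>j0\<^esup>, \<dots>, z\<^bsup>j0+n-1\<^esup>\<close> of monomials,
  whatever they do on the other monomials.\<close>

lemma (in prob_space) su2_poly_small_on_circle:
  assumes ind: "indep_vars (\<lambda>_. borel) \<alpha> {..N}"
    and gauss: "\<And>j. j \<le> N \<Longrightarrow> std_complex_gaussian M (\<alpha> j)"
    and range: "j0 + n \<le> Suc N" and \<eta>: "0 < \<eta>" "\<eta> < cmod \<zeta>" and T: "T \<ge> 0"
  shows "prob {\<omega> \<in> space M. \<forall>k<n. cmod (poly (su2_poly N (\<lambda>j. \<alpha> j \<omega>)) (\<zeta> + of_real \<eta> * unit_root n k)) \<le> T}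
    \<le> (\<Prod>i<n. (T / ((cmod \<zeta> - \<eta>) ^ j0 * \<eta> ^ i) / sqrt (N choose (j0 + i)))\<^sup>2)"
proof -
  have rv[measurable]: "\<alpha> j \<in> borel_measurable M" if "j \<le> N" for j
    using gauss[OF that] by (rule std_complex_gaussian_measurable)
  define z where "z k = \<zeta> + of_real \<eta> * unit_root n k" for k
  define v where "v k = of_real \<eta> * unit_root n k" for k
  define p where "p \<omega> = su2_poly N (\<lambda>j. \<alpha> j \<omega>)" for \<omega>
  \<comment> \<open>The coefficient of \<open>\<alpha> j\<close> in the \<open>i\<close>-th
    functional. Division by \<open>z k ^ j0\<close> shifts the block to the monomials of degree 0 to
    n - 1.\<close>
  define c where "c i j = of_real (sqrt (N choose j)) * (\<Sum>k<n. z k ^ j / z k ^ j0 / v k ^ i) / of_nat n"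
    for i j
  have z: "cmod \<zeta> - \<eta> \<le> cmod (z k)" for k
    using norm_diff_ineq[of \<zeta> "v k"] \<eta> by (simp add: z_def v_def norm_mult)
  have z0: "z k \<noteq> 0" for k using z[of k] \<eta> by auto
  have v: "cmod (v k) = \<eta>" for k using \<eta> by (simp add: v_def norm_mult)
  have c: "c i (j0 + l) = (if l = i then of_real (sqrt (N choose (j0 + i))) else 0)"
    if "l \<le> i" "i < n" for i l
  proof -
    have "c i (j0 + l) = of_real (sqrt (N choose (j0 + l))) * (\<Sum>k<n. z k ^ l / v k ^ i) / of_nat n"
      using z0 by (simp add: c_def power_add)
    also have "(\<Sum>k<n. z k ^ l / v k ^ i) = (if l = i then of_nat n else 0)"
      unfolding z_def v_def using that \<eta> by (intro sum_shifted_unit_roots) auto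
    finally show ?thesis using that by auto
  qed
  \<comment> \<open>The denominator is a lower bound for the modulus of
    \<open>z k ^ j0 * v k ^ i\<close> on the nodes, so values of modulus at most \<open>T\<close>
    force the functional below \<open>\<epsilon> i\<close>.\<close>
  define \<epsilon> where "\<epsilon> i = T / ((cmod \<zeta> - \<eta>) ^ j0 * \<eta> ^ i)" for i
  have sum: "(\<Sum>j\<le>N. c i j * \<alpha> j \<omega>) = (\<Sum>k<n. poly (p \<omega>) (z k) / z k ^ j0 / v k ^ i) / of_nat n"
    for i \<omega>
    by (simp add: c_def p_def poly_su2_poly sum_distrib_left sum_distrib_right sum_divide_distrib
          sum.swap[of _ "{..N}"] mult_ac)
  have imp: "cmod (\<Sum>j\<le>N. c i j * \<alpha> j \<omega>) \<le> \<epsilon> i"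
    if "i < n" "\<forall>k<n. cmod (poly (p \<omega>) (z k)) \<le> T" for i \<omega>
  proof -
    have "cmod (\<Sum>k<n. poly (p \<omega>) (z k) / z k ^ j0 / v k ^ i) \<le> (\<Sum>k<n. \<epsilon> i)"
    proof (rule sum_norm_le)
      fix k assume "k \<in> {..<n}"
      have "cmod (poly (p \<omega>) (z k) / z k ^ j0 / v k ^ i)
          = cmod (poly (p \<omega>) (z k)) / (cmod (z k) ^ j0 * \<eta> ^ i)"
        by (simp add: norm_divide norm_mult norm_power v)
      also have "\<dots> \<le> T / ((cmod \<zeta> - \<eta>) ^ j0 * \<eta> ^ i)"
        using that \<open>k \<in> _\<close> z[of k] \<eta> T
        by (intro frac_le mult_right_mono power_mono) (auto intro!: mult_pos_pos)
      finally show "cmod (poly (p \<omega>) (z k) / z k ^ j0 / v k ^ i) \<le> \<epsilon> i" by (simp add: \<epsilon>_def)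
    qed
    thus ?thesis using that unfolding sum by (simp add: norm_divide field_simps)
  qed
  have "prob {\<omega> \<in> space M. \<forall>k<n. cmod (poly (p \<omega>) (z k)) \<le> T}
      \<le> prob {\<omega> \<in> space M. \<forall>i<n. cmod (\<Sum>j\<le>N. c i j * \<alpha> j \<omega>) \<le> \<epsilon> i}"
    by (rule finite_measure_mono) (use imp in \<open>auto intro!: measurable_sets\<close>)
  also have "\<dots> \<le> (\<Prod>i<n. (\<epsilon> i / cmod (c i (j0 + i)))\<^sup>2)"
  proof (rule triangular_gaussian_small_ball[OF ind gauss range])
    show "c i (j0 + i) \<noteq> 0" if "i < n" for i
      using that range by (subst c) auto
    show "0 \<le> \<epsilon> i" for i using \<eta> T by (simp add: \<epsilon>_def)
  qed (auto simp: c)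
  also have "\<dots> = (\<Prod>i<n. (\<epsilon> i / sqrt (N choose (j0 + i)))\<^sup>2)"
    by (intro prod.cong refl) (simp add: c)
  finally show ?thesis by (simp add: p_def z_def \<epsilon>_def)
qed

section \<open>Binomial weights and the size of SU(2) polynomials on a circle\<close>

text \<open>The weights sum to (1 + s^2)^N, so the largest one, at \<open>j0\<close>, is at least
  the average. Consecutive weights have ratio s^2 (N - j)/(j + 1), and the mode stays far enough
  below \<open>N\<close> for this ratio to be at least s^2/(2(1 + s^2)) along the whole
  block.\<close>

lemma binomial_weight_block_ge:
  fixes s :: real and N :: nat
  assumes s: "s > 0" and N: "real N \<ge> 4 * (1 + s\<^sup>2)"
  shows "\<exists>j0\<le>N. \<forall>i. real i \<le> real N / (4 * (1 + s\<^sup>2)) \<longrightarrow> j0 + i \<le> N \<and>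
    (s\<^sup>2 / (2 * (1 + s\<^sup>2))) ^ i * (1 + s\<^sup>2) ^ N \<le> real (Suc N) * (real (N choose (j0 + i)) * s ^ (2 * (j0 + i)))"
proof -
  define b where "b j = real (N choose j) * s ^ (2 * j)" for j
  define y where "y = 1 / (1 + s\<^sup>2)"
  define q where "q = s\<^sup>2 * y / 2"
  have s2: "1 + s\<^sup>2 > 0" by (simp add: add_pos_nonneg)
  have y: "0 < y" "y < 1" "s\<^sup>2 * y = 1 - y"
    using s s2 by (auto simp: y_def field_simps)
  have yN: "y * real N \<ge> 4" using N s2 by (simp add: y_def field_simps)
  obtain j0 where j0: "j0 \<le> N" "\<And>j. j \<le> N \<Longrightarrow> b j \<le> b j0"
  proof -
    have "Max (b ` {..N}) \<in> b ` {..N}" by (intro Max_in) auto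
    then obtain j0 where "Max (b ` {..N}) = b j0" "j0 \<in> {..N}" by (rule imageE)
    thus ?thesis using that[of j0] by (metis Max_ge atMost_iff finite_atMost finite_imageI imageI)
  qed
  have total: "(1 + s\<^sup>2) ^ N \<le> real (Suc N) * b j0"
  proof -
    have "(1 + s\<^sup>2) ^ N = (\<Sum>j\<le>N. b j)"
      using binomial_ring[of "s\<^sup>2" 1 N] by (simp add: b_def power_mult add.commute)
    also have "\<dots> \<le> (\<Sum>j\<le>N. b j0)" by (intro sum_mono j0) auto
    finally show ?thesis by simp
  qed
  have step: "b (Suc j) * real (Suc j) = b j * (s\<^sup>2 * real (N - j))" for j
  proof -
    have "real (Suc j * (N choose Suc j)) = real ((N - j) * (N choose j))"
      by (metis binomial_absorb_comp binomial_absorption mult.commute)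
    hence "real (N choose Suc j) * real (Suc j) = real (N choose j) * real (N - j)"
      by (simp only: of_nat_mult mult.commute)
    moreover have "b (Suc j) * real (Suc j) = real (N choose Suc j) * real (Suc j) * (s\<^sup>2 * s ^ (2 * j))"
      by (simp add: b_def power2_eq_square mult_ac)
    ultimately show ?thesis by (simp add: b_def mult_ac)
  qed
  \<comment> \<open>The weight at the mode is at least its predecessor, which bounds the mode
    through the ratio formula.\<close>
  have j0_le: "real j0 \<le> real (Suc N) * (1 - y)"
  proof (cases j0)
    case (Suc j)
    have "b j > 0" using s Suc j0 by (auto simp: b_def)
    have "b j * real (Suc j) \<le> b (Suc j) * real (Suc j)"
      using j0(2)[of j] Suc j0(1) by (intro mult_right_mono) auto
    also have "\<dots> = b j * (s\<^sup>2 * real (N - j))" by (rule step)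
    finally have "real (Suc j) \<le> s\<^sup>2 * real (N - j)"
      using \<open>b j > 0\<close> by (simp only: mult_le_cancel_left_pos)
    also have "real (N - j) = real (Suc N) - real j0" using Suc j0(1) by auto
    finally have "real j0 * (1 + s\<^sup>2) \<le> s\<^sup>2 * real (Suc N)" using Suc by (simp add: algebra_simps)
    hence "real j0 \<le> s\<^sup>2 * real (Suc N) * y" using s2 by (simp add: y_def field_simps)
    also have "\<dots> = real (Suc N) * (s\<^sup>2 * y)" by simp
    finally show ?thesis by (simp only: y(3))
  qed (use y in simp)
  have b_pos: "0 \<le> b j" for j using s by (simp add: b_def)
  \<comment> \<open>Here the lower bound on \<open>N\<close> enters: \<open>y * real N\<close> is at
    least 4, so a quarter of it absorbs the extra \<open>1 - y\<close> in the bound for the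
    mode.\<close>
  have room: "real j0 + real i \<le> real N - y * real N / 2" if "real i \<le> y * real N / 4" for i
  proof -
    have "real j0 \<le> real N + 1 - y * real N - y"
      using j0_le by (simp add: algebra_simps)
    thus ?thesis using that y yN by linarith
  qed
  have block: "q ^ i * b j0 \<le> b (j0 + i)" if "real i \<le> y * real N / 4" for i
    using that
  proof (induction i)
    case (Suc i)
    define j where "j = j0 + i"
    have j: "real j \<le> real N - y * real N / 2"
      using room[of i] Suc.prems by (simp add: j_def)
    have jN: "Suc j \<le> N"
    proof -
      have "real j + 1 \<le> real N" using j yN by linarith
      thus ?thesis by linarith
    qed
    \<comment> \<open>The ratio is at least \<open>q\<close> because j + 1 <= N while N - j >=
      yN/2.\<close>
    have "q * b j * real (Suc j) \<le> q * b j * real N"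
      using jN b_pos[of j] y by (intro mult_left_mono) (auto simp: q_def)
    also have "\<dots> = b j * (s\<^sup>2 * (y * real N / 2))" by (simp add: q_def)
    also have "\<dots> \<le> b j * (s\<^sup>2 * real (N - j))"
      using j jN b_pos[of j] by (intro mult_left_mono) (auto simp: of_nat_diff)
    also have "\<dots> = b (Suc j) * real (Suc j)" by (rule step[symmetric])
    finally have "q * b j \<le> b (Suc j)" by (simp only: mult_le_cancel_right)
    moreover have "q * (q ^ i * b j0) \<le> q * b j"
      using Suc y by (intro mult_left_mono) (auto simp: q_def j_def)
    ultimately show ?case by (simp add: j_def mult_ac)
  qed simp
  show ?thesis
  proof (intro exI[of _ j0] conjI allI impI j0(1))
    fix i assume "real i \<le> real N / (4 * (1 + s\<^sup>2))"
    hence i: "real i \<le> y * real N / 4" by (simp add: y_def field_simps)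
    show "j0 + i \<le> N" using room[OF i] yN by linarith
    have "q ^ i * (1 + s\<^sup>2) ^ N \<le> q ^ i * (real (Suc N) * b j0)"
      using y by (intro mult_left_mono total) (auto simp: q_def)
    also have "\<dots> = real (Suc N) * (q ^ i * b j0)" by simp
    also have "\<dots> \<le> real (Suc N) * b (j0 + i)"
      by (intro mult_left_mono block i) simp
    also have "q = s\<^sup>2 / (2 * (1 + s\<^sup>2))" by (simp add: q_def y_def)
    finally show "(s\<^sup>2 / (2 * (1 + s\<^sup>2))) ^ i * (1 + s\<^sup>2) ^ N \<le>
        real (Suc N) * (real (N choose (j0 + i)) * s ^ (2 * (j0 + i)))"
      by (simp only: b_def)
  qed
qed

text \<open>No single weight exceeds the total (1 + s^2)^N, and there are N + 1 terms. This
  polynomial loss is negligible on the exponential scale.\<close>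

lemma su2_poly_upper_bound:
  assumes a: "\<And>j. j \<le> N \<Longrightarrow> cmod (a j) \<le> L" and z: "cmod z = s"
  shows "cmod (poly (su2_poly N a) z) \<le> L * real (Suc N) * sqrt ((1 + s\<^sup>2) ^ N)"
proof -
  have s: "s \<ge> 0" using z by auto
  have "cmod (poly (su2_poly N a) z) \<le> (\<Sum>j\<le>N. L * sqrt ((1 + s\<^sup>2) ^ N))"
    unfolding poly_su2_poly
  proof (rule sum_norm_le)
    fix j assume j: "j \<in> {..N}"
    have "real (N choose j) * s ^ (2 * j) \<le> (\<Sum>j\<le>N. real (N choose j) * s ^ (2 * j))"
      using j s by (intro member_le_sum) auto
    also have "\<dots> = (1 + s\<^sup>2) ^ N"
      using binomial_ring[of "s\<^sup>2" 1 N] by (simp add: power_mult add.commute)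
    finally have "sqrt (real (N choose j) * s ^ (2 * j)) \<le> sqrt ((1 + s\<^sup>2) ^ N)" by simp
    also have "s ^ (2 * j) = (s ^ j)\<^sup>2" by (simp add: power_mult[symmetric] mult.commute)
    finally have "sqrt (real (N choose j)) * s ^ j \<le> sqrt ((1 + s\<^sup>2) ^ N)"
      using s by (simp add: real_sqrt_mult)
    hence "cmod (a j) * (sqrt (real (N choose j)) * s ^ j) \<le> L * sqrt ((1 + s\<^sup>2) ^ N)"
      using a[of j] j s by (intro mult_mono) (auto intro: order_trans[OF norm_ge_zero])
    thus "cmod (a j * complex_of_real (sqrt (real (N choose j))) * z ^ j) \<le> L * sqrt ((1 + s\<^sup>2) ^ N)"
      using z by (simp add: norm_mult norm_power mult.assoc)
  qed
  thus ?thesis by (simp add: mult_ac)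
qed

lemma degree_su2_poly_le: "degree (su2_poly N a) \<le> N"
  unfolding su2_poly_def by (intro degree_sum_le) (auto intro: order_trans[OF degree_monom_le])

lemma su2_poly_eq_0_iff: "su2_poly N a = 0 \<longleftrightarrow> (\<forall>j\<le>N. a j = 0)"
proof
  assume *: "su2_poly N a = 0"
  show "\<forall>j\<le>N. a j = 0"
  proof (intro allI impI)
    fix j assume "j \<le> N"
    have "coeff (su2_poly N a) j = a j * complex_of_real (sqrt (real (N choose j)))"
      using \<open>j \<le> N\<close> by (simp add: su2_poly_def coeff_sum)
    thus "a j = 0" using * \<open>j \<le> N\<close> by simp
  qed
qed (simp add: su2_poly_def)

text \<open>About \<open>\<kappa> * N\<close> nodes on a small circle around \<open>\<zeta>\<close>
  yield as many triangular functionals. Each contributes a factor at most exp(-delta N), whence a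
  rate quadratic in \<open>N\<close>. The set \<open>Z\<close> is chosen before the probability
  space.\<close>

lemma su2_poly_small_near_point:
  fixes s \<delta> \<eta>0 :: real
  assumes s: "s > 0" and \<delta>: "\<delta> > 0" and \<eta>0: "\<eta>0 > 0"
  shows "\<exists>A>0. \<exists>N0. \<forall>N>N0. \<forall>\<zeta>. cmod \<zeta> = s \<longrightarrow> (\<exists>Z \<subseteq> cball \<zeta> \<eta>0. finite Z \<and>
    (\<forall>(M :: 'a measure) \<alpha>. prob_space M \<longrightarrow> iid_std_complex_gaussian M N \<alpha> \<longrightarrow>
      measure M {\<omega> \<in> space M. \<forall>z\<in>Z. cmod (poly (su2_poly N (\<lambda>j. \<alpha> j \<omega>)) z)
          \<le> exp (- \<delta> * real N) * sqrt ((1 + s\<^sup>2) ^ N)} \<le> exp (- A * (real N)\<^sup>2)))"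
proof -
  \<comment> \<open>The bound \<open>s / 2\<close> keeps \<open>\<eta>\<close> below
    \<open>s\<close>; the last one keeps \<open>s ^ j0\<close> within a factor
    \<open>exp (\<delta> / 8 * real j0)\<close> of \<open>(s - \<eta>) ^ j0\<close>.\<close>
  define \<eta> where "\<eta> = min \<eta>0 (min (s / 2) (s * (1 - exp (- \<delta> / 8))))"
  have "\<eta> \<le> s / 2" "\<eta> \<le> s * (1 - exp (- \<delta> / 8))"
    unfolding \<eta>_def by (simp_all only: min.coboundedI2 min.cobounded1 min.cobounded2)
  hence \<eta>: "0 < \<eta>" "\<eta> \<le> \<eta>0" "\<eta> \<le> s / 2" "s * exp (- \<delta> / 8) \<le> s - \<eta>"
    using s \<delta> \<eta>0 by (auto simp: \<eta>_def algebra_simps)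
  have \<eta>s: "\<eta> < s" using \<eta>(3) s by linarith
  have s2: "1 + s\<^sup>2 > 0" by (simp add: add_pos_nonneg)
  define q where "q = s\<^sup>2 / (2 * (1 + s\<^sup>2))"
  have q: "0 < q" "q < 1" using s s2 by (auto simp: q_def field_simps add_pos_nonneg)
  \<comment> \<open>The loss per index inside the block, after squaring: \<open>\<eta>\<close> in
    place of \<open>s\<close>, and the decay \<open>q\<close> of the weights. Below,
    \<open>\<kappa>\<close> is small enough for the block to fit and for the total loss to stay
    below exp(delta N/4).\<close>
  define G where "G = (s / \<eta>)\<^sup>2 / q"
  have "(s / \<eta>)\<^sup>2 \<ge> 1" using \<eta> \<eta>s by (intro one_le_power) auto
  hence G: "G > 1" unfolding G_def using q by (simp add: less_divide_eq)
  define \<kappa> where "\<kappa> = min (1 / (4 * (1 + s\<^sup>2))) (\<delta> / (4 * ln G))"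
  have \<kappa>: "\<kappa> > 0" "\<kappa> \<le> 1 / (4 * (1 + s\<^sup>2))" "\<kappa> * ln G \<le> \<delta> / 4"
  proof -
    have "\<kappa> \<le> \<delta> / (4 * ln G)" by (simp add: \<kappa>_def)
    thus "\<kappa> * ln G \<le> \<delta> / 4" using G by (simp add: pos_le_divide_eq)
  qed (use G \<delta> s2 in \<open>auto simp: \<kappa>_def\<close>)
  have "eventually (\<lambda>N. real (Suc N) \<le> exp (\<delta> / 4 * real N)) sequentially"
    using \<delta> by real_asymp
  then obtain N1 where N1: "\<And>N. N \<ge> N1 \<Longrightarrow> real (Suc N) \<le> exp (\<delta> / 4 * real N)"
    unfolding eventually_sequentially by blast
  \<comment> \<open>The term \<open>2 / \<kappa>\<close> ensures that
    \<open>\<kappa> * real N\<close> is at least 2, so rounding it down to \<open>n\<close> loses at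
    most a factor 2.\<close>
  define N0 where "N0 = max N1 (max (nat \<lceil>2 / \<kappa>\<rceil>) (nat \<lceil>4 * (1 + s\<^sup>2)\<rceil>))"
  show ?thesis
  proof (intro exI[of _ "\<delta> * \<kappa> / 2"] exI[of _ N0] conjI allI impI)
    show "0 < \<delta> * \<kappa> / 2" using \<delta> \<kappa> by simp
  next
    fix N :: nat and \<zeta> :: complex
    assume N: "N > N0" and \<zeta>: "cmod \<zeta> = s"
    have N': "N \<ge> N1" "real N \<ge> 2 / \<kappa>" "real N \<ge> 4 * (1 + s\<^sup>2)"
      using N unfolding N0_def by (auto simp: nat_less_iff ceiling_less_iff) linarith+
    define n where "n = nat \<lfloor>\<kappa> * real N\<rfloor>"
    have n: "real n \<le> \<kappa> * real N" "real n \<ge> \<kappa> * real N / 2"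
    proof -
      have "\<kappa> * real N \<ge> 2" using N'(2) \<kappa> by (simp add: field_simps)
      thus "real n \<le> \<kappa> * real N" "real n \<ge> \<kappa> * real N / 2"
        unfolding n_def by linarith+
    qed
    obtain j0 where j0: "j0 \<le> N" "\<And>i. real i \<le> real N / (4 * (1 + s\<^sup>2)) \<Longrightarrow> j0 + i \<le> N"
      "\<And>i. real i \<le> real N / (4 * (1 + s\<^sup>2)) \<Longrightarrow>
        q ^ i * (1 + s\<^sup>2) ^ N \<le> real (Suc N) * (real (N choose (j0 + i)) * s ^ (2 * (j0 + i)))"
      using binomial_weight_block_ge[OF s N'(3)] unfolding q_def by blast
    have i_le: "real i \<le> real N / (4 * (1 + s\<^sup>2))" if "i \<le> n" for i
    proof -
      have "real i \<le> \<kappa> * real N" using that n(1) by linarith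
      also have "\<dots> \<le> 1 / (4 * (1 + s\<^sup>2)) * real N" by (intro mult_right_mono \<kappa>) auto
      finally show ?thesis by simp
    qed
    define T where "T = exp (- \<delta> * real N) * sqrt ((1 + s\<^sup>2) ^ N)"
    have T: "T \<ge> 0" using s2 by (simp add: T_def)
    \<comment> \<open>Budget: the square of \<open>T\<close> carries exp(-2 delta N). The factor N +
      1, the change of radius and the power of \<open>G\<close> each give back at most exp(delta
      N/4), leaving exp(-5 delta N/4).\<close>
    have bound: "(T / ((s - \<eta>) ^ j0 * \<eta> ^ i) / sqrt (N choose (j0 + i)))\<^sup>2 \<le> exp (- \<delta> * real N)"
      if i: "i < n" for i
    proof -
      define b where "b = real (N choose (j0 + i))"
      have b: "b > 0" using j0(2)[OF i_le[of i]] i by (simp add: b_def)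
      define D where "D = ((s - \<eta>) ^ j0 * \<eta> ^ i)\<^sup>2 * b"
      have D: "D > 0" using \<eta> \<eta>s b by (simp add: D_def)
      have "(1 + s\<^sup>2) ^ N \<le> real (Suc N) * (b * s ^ (2 * (j0 + i))) / q ^ i"
        using j0(3)[OF i_le[of i]] i q by (simp add: field_simps b_def)
      also have "s ^ (2 * (j0 + i)) = (s ^ j0)\<^sup>2 * (s ^ i)\<^sup>2"
        by (simp add: power_add power_mult[symmetric] mult.commute distrib_left)
      also have "real (Suc N) * (b * ((s ^ j0)\<^sup>2 * (s ^ i)\<^sup>2)) / q ^ i
          \<le> real (Suc N) * (b * ((exp (\<delta> / 8 * real j0) * (s - \<eta>) ^ j0)\<^sup>2 * (s ^ i)\<^sup>2)) / q ^ i"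
      proof -
        have "s \<le> exp (\<delta> / 8) * (s - \<eta>)"
          using \<eta>(4) by (simp add: exp_minus field_simps)
        hence "s ^ j0 \<le> (exp (\<delta> / 8) * (s - \<eta>)) ^ j0" using s by (intro power_mono) auto
        also have "\<dots> = exp (\<delta> / 8 * real j0) * (s - \<eta>) ^ j0"
          by (simp add: power_mult_distrib exp_of_nat_mult[symmetric] mult.commute)
        finally show ?thesis using s q b
          by (intro divide_right_mono mult_left_mono mult_right_mono power_mono) auto
      qed
      also have "\<dots> = real (Suc N) * (exp (\<delta> / 8 * real j0))\<^sup>2 * (((s / \<eta>)\<^sup>2) ^ i / q ^ i) * D"
        using \<eta> by (simp add: D_def power_mult_distrib power_divide power_mult[symmetric] mult_ac)
      also have "((s / \<eta>)\<^sup>2) ^ i / q ^ i = G ^ i" by (simp only: G_def power_divide)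
      also have "(exp (\<delta> / 8 * real j0))\<^sup>2 = exp (\<delta> / 4 * real j0)"
        by (simp add: power2_eq_square exp_add[symmetric])
      also have "real (Suc N) * exp (\<delta> / 4 * real j0) * G ^ i * D
          \<le> exp (\<delta> / 4 * real N) * exp (\<delta> / 4 * real N) * exp (\<delta> / 4 * real N) * D"
      proof -
        have "G ^ i \<le> G ^ n" using G i by (intro power_increasing) auto
        also have "G ^ n = exp (real n * ln G)" using G by (simp add: exp_of_nat_mult)
        also have "real n * ln G \<le> (\<kappa> * real N) * ln G" using n G by (intro mult_right_mono) auto
        also have "\<dots> = (\<kappa> * ln G) * real N" by simp
        also have "\<dots> \<le> \<delta> / 4 * real N" by (intro mult_right_mono \<kappa>) simp
        finally have "G ^ i \<le> exp (\<delta> / 4 * real N)" by simp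
        moreover have "exp (\<delta> / 4 * real j0) \<le> exp (\<delta> / 4 * real N)"
          using j0(1) \<delta> by simp
        ultimately show ?thesis using N1[OF N'(1)] D G
          by (intro mult_right_mono mult_mono) auto
      qed
      finally have "(1 + s\<^sup>2) ^ N \<le> exp (3 * \<delta> / 4 * real N) * D"
        by (simp add: exp_add[symmetric] field_simps)
      hence "T\<^sup>2 \<le> exp (- 2 * \<delta> * real N) * (exp (3 * \<delta> / 4 * real N) * D)"
        using s2 by (simp add: T_def power_mult_distrib exp_double[symmetric] mult_ac)
      also have "\<dots> = exp (- 2 * \<delta> * real N + 3 * \<delta> / 4 * real N) * D"
        by (simp only: exp_add mult.assoc)
      also have "\<dots> \<le> exp (- \<delta> * real N) * D"
        using \<delta> D by (intro mult_right_mono) (auto simp: field_simps)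
      finally have "T\<^sup>2 / D \<le> exp (- \<delta> * real N)" using D by (simp add: field_simps)
      thus ?thesis using b by (simp add: D_def b_def power_divide power_mult_distrib)
    qed
    define Z where "Z = (\<lambda>k. \<zeta> + of_real \<eta> * unit_root n k) ` {..<n}"
    show "\<exists>Z \<subseteq> cball \<zeta> \<eta>0. finite Z \<and>
      (\<forall>(M :: 'a measure) \<alpha>. prob_space M \<longrightarrow> iid_std_complex_gaussian M N \<alpha> \<longrightarrow>
      measure M {\<omega> \<in> space M. \<forall>z\<in>Z. cmod (poly (su2_poly N (\<lambda>j. \<alpha> j \<omega>)) z)
          \<le> exp (- \<delta> * real N) * sqrt ((1 + s\<^sup>2) ^ N)} \<le> exp (- (\<delta> * \<kappa> / 2) * (real N)\<^sup>2))"
    proof (intro exI[of _ Z] conjI allI impI)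
      show "Z \<subseteq> cball \<zeta> \<eta>0" using \<eta> by (auto simp: Z_def dist_norm norm_mult)
      show "finite Z" by (simp add: Z_def)
      fix M :: "'a measure" and \<alpha>
      assume "prob_space M" and iid: "iid_std_complex_gaussian M N \<alpha>"
      then interpret prob_space M by simp
      have "prob {\<omega> \<in> space M. \<forall>z\<in>Z. cmod (poly (su2_poly N (\<lambda>j. \<alpha> j \<omega>)) z) \<le> T}
          = prob {\<omega> \<in> space M. \<forall>k<n. cmod (poly (su2_poly N (\<lambda>j. \<alpha> j \<omega>)) (\<zeta> + of_real \<eta> * unit_root n k)) \<le> T}"
        by (rule arg_cong[where f = prob]) (auto simp: Z_def)
      also have "\<dots> \<le> (\<Prod>i<n. (T / ((cmod \<zeta> - \<eta>) ^ j0 * \<eta> ^ i) / sqrt (N choose (j0 + i)))\<^sup>2)"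
        using iid j0(2)[OF i_le[of n]] \<eta> \<eta>s \<zeta> T
        by (intro su2_poly_small_on_circle) (auto simp: iid_std_complex_gaussian_def)
      also have "\<dots> \<le> (\<Prod>i<n. exp (- \<delta> * real N))"
        using bound by (intro prod_mono) (auto simp: \<zeta>)
      also have "\<dots> = exp (real n * (- \<delta> * real N))"
        by (simp only: exp_of_nat_mult prod_constant card_lessThan)
      also have "\<dots> \<le> exp (- (\<delta> * \<kappa> / 2) * (real N)\<^sup>2)"
      proof -
        have "\<kappa> * real N / 2 * (\<delta> * real N) \<le> real n * (\<delta> * real N)"
          using n \<delta> by (intro mult_right_mono) auto
        thus ?thesis by (simp add: power2_eq_square mult_ac)
      qed
      finally show "prob {\<omega> \<in> space M. \<forall>z\<in>Z. cmod (poly (su2_poly N (\<lambda>j. \<alpha> j \<omega>)) z)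
          \<le> exp (- \<delta> * real N) * sqrt ((1 + s\<^sup>2) ^ N)} \<le> exp (- (\<delta> * \<kappa> / 2) * (real N)\<^sup>2)"
        by (simp only: T_def)
    qed
  qed
qed

section \<open>Concentration\<close>

text \<open>The number \<open>m\<close> of nodes on the circle does not depend on \<open>N\<close>,
  so the union bound over nodes and coefficients costs only a factor linear in
  \<open>N\<close>.\<close>

lemma ln_mahler_su2_poly_concentration:
  fixes s \<delta> :: real
  assumes s: "s > 0" and \<delta>: "\<delta> > 0"
  shows "\<exists>A>0. \<exists>N0. \<forall>N>N0. \<forall>(M :: 'a measure) \<alpha>. prob_space M \<longrightarrow> iid_std_complex_gaussian M N \<alpha> \<longrightarrow>
    (\<exists>F\<in>sets M. measure M F \<le> exp (- A * (real N)\<^sup>2) \<and>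
      (\<forall>\<omega>\<in>space M - F. su2_poly N (\<lambda>j. \<alpha> j \<omega>) \<noteq> 0 \<and>
        \<bar>ln (mahler s (su2_poly N (\<lambda>j. \<alpha> j \<omega>))) - real N * (ln (1 + s\<^sup>2) / 2)\<bar> \<le> \<delta> * real N))"
proof -
  have s2: "1 + s\<^sup>2 > 0" by (simp add: add_pos_nonneg)
  \<comment> \<open>With this choice the factor \<open>3 ^ N\<close>, shared among \<open>m\<close>
    nodes, costs at most exp(delta N/2) per node; the other half of \<open>\<delta>\<close> goes
    into the threshold \<open>T\<close>.\<close>
  define m where "m = Suc (nat \<lceil>2 * ln 3 / \<delta>\<rceil>)"
  have m: "m > 0" "ln 3 \<le> \<delta> / 2 * real m"
  proof -
    have "2 * ln 3 / \<delta> \<le> real m" unfolding m_def by linarith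
    thus "ln 3 \<le> \<delta> / 2 * real m" using \<delta> by (simp add: field_simps)
  qed (simp add: m_def)
  define \<eta> where "\<eta> = s / (real m * 3 ^ m)"
  have \<eta>: "\<eta> > 0" using s m by (simp add: \<eta>_def)
  obtain A1 N1 where A1: "A1 > 0" and local: "\<forall>N>N1. \<forall>\<zeta>. cmod \<zeta> = s \<longrightarrow> (\<exists>Z \<subseteq> cball \<zeta> \<eta>. finite Z \<and>
    (\<forall>(M :: 'a measure) \<alpha>. prob_space M \<longrightarrow> iid_std_complex_gaussian M N \<alpha> \<longrightarrow>
      measure M {\<omega> \<in> space M. \<forall>z\<in>Z. cmod (poly (su2_poly N (\<lambda>j. \<alpha> j \<omega>)) z)
          \<le> exp (- (\<delta> / 2) * real N) * sqrt ((1 + s\<^sup>2) ^ N)} \<le> exp (- A1 * (real N)\<^sup>2)))"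
    using su2_poly_small_near_point[OF s half_gt_zero[OF \<delta>] \<eta>, where 'a = 'a]
    by (elim exE conjE) (rule that)
  \<comment> \<open>The rate is halved so that \<open>exp (A * (real N)\<^sup>2)\<close> can absorb
    the prefactor of the union bound; 1/2 is the tail rate for a coefficient of modulus at least
    \<open>N\<close>.\<close>
  define A where "A = min A1 (1 / 2) / 2"
  have A: "A > 0" "2 * A \<le> A1" "2 * A \<le> 1 / 2" using A1 by (auto simp: A_def)
  have "eventually (\<lambda>N. real m + 2 * real (Suc N) \<le> exp (A * (real N)\<^sup>2)) sequentially"
    using A(1) by real_asymp
  moreover have "eventually (\<lambda>N. ln (real N * real (Suc N)) \<le> \<delta> * real N) sequentially"
    using \<delta> by real_asymp
  ultimately have "eventually (\<lambda>N. N > N1 \<and> N > 0 \<and> real m + 2 * real (Suc N) \<le> exp (A * (real N)\<^sup>2) \<and>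
      ln (real N * real (Suc N)) \<le> \<delta> * real N) sequentially"
    using eventually_gt_at_top[of N1] eventually_gt_at_top[of 0] by eventually_elim simp
  then obtain N0 where N0: "\<And>N. N > N0 \<Longrightarrow> N > N1 \<and> N > 0 \<and>
      real m + 2 * real (Suc N) \<le> exp (A * (real N)\<^sup>2) \<and> ln (real N * real (Suc N)) \<le> \<delta> * real N"
    unfolding eventually_sequentially by (metis less_imp_le)
  show ?thesis
  proof (intro exI[of _ A] exI[of _ N0] conjI allI impI A(1))
    fix N :: nat and M :: "'a measure" and \<alpha>
    assume "N > N0" and "prob_space M" and iid: "iid_std_complex_gaussian M N \<alpha>"
    interpret prob_space M by fact
    note N = N0[OF \<open>N > N0\<close>, THEN conjunct1] N0[OF \<open>N > N0\<close>, THEN conjunct2, THEN conjunct1]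
      N0[OF \<open>N > N0\<close>, THEN conjunct2, THEN conjunct2, THEN conjunct1]
      N0[OF \<open>N > N0\<close>, THEN conjunct2, THEN conjunct2, THEN conjunct2]
    have gauss: "std_complex_gaussian M (\<alpha> j)" if "j \<le> N" for j
      using iid that by (simp add: iid_std_complex_gaussian_def)
    have rv[measurable]: "\<alpha> j \<in> borel_measurable M" if "j \<le> N" for j
      using gauss[OF that] by (rule std_complex_gaussian_measurable)
    define P where "P \<omega> = su2_poly N (\<lambda>j. \<alpha> j \<omega>)" for \<omega>
    have P[measurable]: "(\<lambda>\<omega>. poly (P \<omega>) z) \<in> borel_measurable M" for z
      unfolding P_def poly_su2_poly by measurable
    define T where "T = exp (- (\<delta> / 2) * real N) * sqrt ((1 + s\<^sup>2) ^ N)"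
    have T: "T > 0" using s2 by (simp add: T_def)
    define near where "near k Z \<longleftrightarrow> Z \<subseteq> cball (of_real s * unit_root m k) \<eta> \<and> finite Z \<and>
        prob {\<omega> \<in> space M. \<forall>z\<in>Z. cmod (poly (P \<omega>) z) \<le> T} \<le> exp (- A1 * (real N)\<^sup>2)" for k Z
    have "\<exists>Z. near k Z" for k
    proof -
      have "cmod (of_real s * unit_root m k) = s" using s by (simp add: norm_mult)
      from local[rule_format, OF N(1) this] obtain Z where
        "Z \<subseteq> cball (of_real s * unit_root m k) \<eta>" "finite Z" and
        Z: "\<forall>(M :: 'a measure) \<alpha>. prob_space M \<longrightarrow> iid_std_complex_gaussian M N \<alpha> \<longrightarrow>
          measure M {\<omega> \<in> space M. \<forall>z\<in>Z. cmod (poly (su2_poly N (\<lambda>j. \<alpha> j \<omega>)) z)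
            \<le> exp (- (\<delta> / 2) * real N) * sqrt ((1 + s\<^sup>2) ^ N)} \<le> exp (- A1 * (real N)\<^sup>2)"
        by (elim exE conjE) (rule that)
      with Z[rule_format, OF \<open>prob_space M\<close> iid] show ?thesis
        unfolding near_def P_def T_def by (intro exI[of _ Z] conjI)
    qed
    then obtain Z where "\<And>k. near k (Z k)" by metis
    hence Z: "\<And>k. Z k \<subseteq> cball (of_real s * unit_root m k) \<eta>" "\<And>k. finite (Z k)"
      "\<And>k. prob {\<omega> \<in> space M. \<forall>z\<in>Z k. cmod (poly (P \<omega>) z) \<le> T} \<le> exp (- A1 * (real N)\<^sup>2)"
      unfolding near_def by simp_all
    \<comment> \<open>On \<open>F1 k\<close> every candidate near the \<open>k\<close>-th node
      fails; off it some point of \<open>Z k\<close> has a value above \<open>T\<close> and can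
      replace the exact node.\<close>
    define F1 where "F1 k = {\<omega> \<in> space M. \<forall>z\<in>Z k. cmod (poly (P \<omega>) z) \<le> T}" for k
    define F2 where "F2 j = {\<omega> \<in> space M. real N \<le> cmod (\<alpha> j \<omega>)}" for j
    have F1: "F1 k \<in> sets M" for k
      unfolding F1_def using Z(2)[of k] by (intro sets.sets_Collect_finite_All) measurable
    have F2: "F2 j \<in> sets M" if "j \<le> N" for j
      using rv[OF that] unfolding F2_def by measurable
    define F where "F = (\<Union>k<m. F1 k) \<union> (\<Union>j\<le>N. F2 j)"
    show "\<exists>F\<in>sets M. measure M F \<le> exp (- A * (real N)\<^sup>2) \<and>
      (\<forall>\<omega>\<in>space M - F. su2_poly N (\<lambda>j. \<alpha> j \<omega>) \<noteq> 0 \<and>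
        \<bar>ln (mahler s (su2_poly N (\<lambda>j. \<alpha> j \<omega>))) - real N * (ln (1 + s\<^sup>2) / 2)\<bar> \<le> \<delta> * real N)"
    proof (intro bexI[of _ F] conjI ballI)
      show "F \<in> sets M" unfolding F_def using F1 F2 by (intro sets.Un sets.finite_UN) auto
      have "prob F \<le> prob (\<Union>k<m. F1 k) + prob (\<Union>j\<le>N. F2 j)"
        unfolding F_def using F1 F2 by (intro measure_Un_le sets.finite_UN) auto
      also have "prob (\<Union>k<m. F1 k) \<le> (\<Sum>k<m. prob (F1 k))"
        using F1 by (intro measure_UNION_le) auto
      also have "\<dots> \<le> (\<Sum>k<m. exp (- A1 * (real N)\<^sup>2))"
        unfolding F1_def by (intro sum_mono Z)
      also have "\<dots> \<le> real m * exp (- 2 * A * (real N)\<^sup>2)"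
        using A(2) by (auto intro!: mult_left_mono mult_right_mono)
      also have "prob (\<Union>j\<le>N. F2 j) \<le> (\<Sum>j\<le>N. prob (F2 j))"
        using F2 by (intro measure_UNION_le) auto
      also have "\<dots> \<le> (\<Sum>j\<le>N. 2 * exp (- (real N)\<^sup>2 / 2))"
        unfolding F2_def by (intro sum_mono std_complex_gaussian_tail gauss) auto
      also have "\<dots> = 2 * real (Suc N) * exp (- (real N)\<^sup>2 / 2)" by simp
      also have "\<dots> \<le> 2 * real (Suc N) * exp (- 2 * A * (real N)\<^sup>2)"
      proof -
        have "2 * A * (real N)\<^sup>2 \<le> 1 / 2 * (real N)\<^sup>2" by (intro mult_right_mono A) simp
        thus ?thesis by (intro mult_left_mono) auto
      qed
      also have "real m * exp (- 2 * A * (real N)\<^sup>2) + 2 * real (Suc N) * exp (- 2 * A * (real N)\<^sup>2)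
          = (real m + 2 * real (Suc N)) * exp (- 2 * A * (real N)\<^sup>2)"
        by (simp only: distrib_right)
      also have "\<dots> \<le> exp (A * (real N)\<^sup>2) * exp (- 2 * A * (real N)\<^sup>2)"
        by (intro mult_right_mono N(3)) simp
      also have "\<dots> = exp (- A * (real N)\<^sup>2)"
        by (simp add: exp_add[symmetric])
      finally show "prob F \<le> exp (- A * (real N)\<^sup>2)" by simp
    next
      fix \<omega> assume \<omega>: "\<omega> \<in> space M - F"
      have "\<exists>z. z \<in> Z k \<and> T < cmod (poly (P \<omega>) z)" if "k < m" for k
        using \<omega> that by (auto simp: F_def F1_def not_le)
      then obtain z where z: "\<And>k. k < m \<Longrightarrow> z k \<in> Z k" "\<And>k. k < m \<Longrightarrow> T < cmod (poly (P \<omega>) (z k))"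
        by metis
      \<comment> \<open>A single value above the positive threshold suffices, and there is one
        because \<open>m\<close> is positive.\<close>
      show nz: "su2_poly N (\<lambda>j. \<alpha> j \<omega>) \<noteq> 0"
        using z(2)[OF m(1)] T by (auto simp: P_def)
      hence nz': "P \<omega> \<noteq> 0" by (simp add: P_def)
      have mp: "mahler s (P \<omega>) > 0" by (rule mahler_pos[OF nz' s])
      have lnsqrt: "ln (sqrt ((1 + s\<^sup>2) ^ N)) = real N * (ln (1 + s\<^sup>2) / 2)"
        using s2 by (simp add: ln_sqrt ln_realpow)
      have "T ^ m \<le> (\<Prod>k<m. cmod (poly (P \<omega>) (z k)))"
        using prod_mono[of "{..<m}" "\<lambda>_. T" "\<lambda>k. cmod (poly (P \<omega>) (z k))"] T z(2)
        by (auto intro: less_imp_le)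
      also have "\<dots> \<le> 3 ^ degree (P \<omega>) * mahler s (P \<omega>) ^ m"
      proof (rule prod_poly_perturbed_unit_roots_le[OF m(1) s])
        show "\<eta> \<le> s / (real m * 3 ^ m)" by (simp add: \<eta>_def)
        show "cmod (z k - of_real s * unit_root m k) \<le> \<eta>" if "k < m" for k
          using z(1)[OF that] Z(1)[of k] by (auto simp: dist_norm norm_minus_commute)
      qed
      also have "\<dots> \<le> 3 ^ N * mahler s (P \<omega>) ^ m"
        using mp degree_su2_poly_le[of N] unfolding P_def
        by (intro mult_right_mono power_increasing) auto
      finally have "ln (T ^ m) \<le> ln (3 ^ N * mahler s (P \<omega>) ^ m)"
        using T mp by (subst ln_le_cancel_iff) auto
      hence "real m * ln T \<le> real N * ln 3 + real m * ln (mahler s (P \<omega>))"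
        using T mp by (simp add: ln_mult_pos ln_realpow)
      also have "real N * ln 3 \<le> real N * (\<delta> / 2 * real m)"
        by (intro mult_left_mono m) simp
      finally have "real m * ln T \<le> real m * (real N * \<delta> / 2 + ln (mahler s (P \<omega>)))"
        by (simp add: algebra_simps)
      hence "ln T \<le> real N * \<delta> / 2 + ln (mahler s (P \<omega>))"
        using m(1) by simp
      moreover have "ln T = - (\<delta> / 2) * real N + real N * (ln (1 + s\<^sup>2) / 2)"
        unfolding T_def using s2 by (subst ln_mult_pos) (auto simp: lnsqrt)
      ultimately have lower: "real N * (ln (1 + s\<^sup>2) / 2) - ln (mahler s (P \<omega>)) \<le> \<delta> * real N"
        by (simp add: algebra_simps)
      have "mahler s (P \<omega>) \<le> real N * real (Suc N) * sqrt ((1 + s\<^sup>2) ^ N)"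
        unfolding P_def
      proof (intro mahler_le_max_circle su2_poly_upper_bound s)
        show "cmod (\<alpha> j \<omega>) \<le> real N" if "j \<le> N" for j
          using \<omega> that by (force simp: F_def F2_def)
      qed
      hence "ln (mahler s (P \<omega>)) \<le> ln (real N * real (Suc N) * sqrt ((1 + s\<^sup>2) ^ N))"
        using mp by (intro ln_mono) auto
      also have "\<dots> = ln (real N * real (Suc N)) + real N * (ln (1 + s\<^sup>2) / 2)"
        unfolding lnsqrt[symmetric] using N(2) s2 by (subst ln_mult_pos) auto
      also have "\<dots> \<le> \<delta> * real N + real N * (ln (1 + s\<^sup>2) / 2)"
        using N(4) by simp
      finally show "\<bar>ln (mahler s (su2_poly N (\<lambda>j. \<alpha> j \<omega>))) - real N * (ln (1 + s\<^sup>2) / 2)\<bar> \<le> \<delta> * real N"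
        using lower unfolding P_def by linarith
    qed
  qed
qed

text \<open>The limiting density \<open>r\<^sup>2 / (1 + r\<^sup>2)\<close> is the derivative of \<open>ln (1 + t\<^sup>2) / 2\<close> with respect
  to \<open>ln t\<close> at \<open>t = r\<close>.\<close>

lemma ln_one_plus_square_log_derivative:
  fixes r \<Delta> :: real
  assumes r: "r > 0" and \<Delta>: "\<Delta> > 0"
  obtains h where "h > 0"
    "ln (1 + (r * exp h)\<^sup>2) / 2 - ln (1 + r\<^sup>2) / 2 < h * (r\<^sup>2 / (1 + r\<^sup>2) + \<Delta>)"
    "ln (1 + r\<^sup>2) / 2 - ln (1 + (r * exp (- h))\<^sup>2) / 2 > h * (r\<^sup>2 / (1 + r\<^sup>2) - \<Delta>)"
proof -
  \<comment> \<open>In the variable u = ln(t/r) the logarithmic derivative becomes an ordinary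
    derivative at 0. Its two-sided limit lets one step size serve both estimates.\<close>
  define f where "f u = ln (1 + (r * exp u)\<^sup>2) / 2" for u
  have pos: "1 + (r * exp u)\<^sup>2 > 0" for u by (simp add: add_pos_nonneg)
  have "(f has_real_derivative r\<^sup>2 / (1 + r\<^sup>2)) (at 0)"
    unfolding f_def using pos[of 0]
    by (auto intro!: derivative_eq_intros simp: power2_eq_square field_simps)
  hence "((\<lambda>h. (f h - f 0) / h) \<longlongrightarrow> r\<^sup>2 / (1 + r\<^sup>2)) (at 0)"
    by (simp add: DERIV_def)
  from tendstoD[OF this \<Delta>] obtain d where d: "d > 0"
    "\<And>h. h \<noteq> 0 \<Longrightarrow> \<bar>h\<bar> < d \<Longrightarrow> \<bar>(f h - f 0) / h - r\<^sup>2 / (1 + r\<^sup>2)\<bar> < \<Delta>"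
    unfolding eventually_at dist_real_def by auto
  show ?thesis
  proof (rule that[of "d / 2"])
    show "d / 2 > 0" using d by simp
    have "\<bar>(f (d / 2) - f 0) / (d / 2) - r\<^sup>2 / (1 + r\<^sup>2)\<bar> < \<Delta>"
      using d(1) by (intro d(2)) auto
    hence "(f (d / 2) - f 0) / (d / 2) < r\<^sup>2 / (1 + r\<^sup>2) + \<Delta>" by linarith
    hence "f (d / 2) - f 0 < (d / 2) * (r\<^sup>2 / (1 + r\<^sup>2) + \<Delta>)"
      using d(1) by (subst (asm) pos_divide_less_eq) (auto simp: mult.commute)
    thus "ln (1 + (r * exp (d / 2))\<^sup>2) / 2 - ln (1 + r\<^sup>2) / 2 < d / 2 * (r\<^sup>2 / (1 + r\<^sup>2) + \<Delta>)"
      by (simp add: f_def)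
    have "\<bar>(f (- (d / 2)) - f 0) / (- (d / 2)) - r\<^sup>2 / (1 + r\<^sup>2)\<bar> < \<Delta>"
      using d(1) by (intro d(2)) auto
    moreover have "(f (- (d / 2)) - f 0) / (- (d / 2)) = (f 0 - f (- (d / 2))) / (d / 2)"
      by (simp add: divide_simps)
    ultimately have "r\<^sup>2 / (1 + r\<^sup>2) - \<Delta> < (f 0 - f (- (d / 2))) / (d / 2)" by linarith
    hence "(d / 2) * (r\<^sup>2 / (1 + r\<^sup>2) - \<Delta>) < f 0 - f (- (d / 2))"
      using d(1) by (subst (asm) pos_less_divide_eq) (auto simp: mult.commute)
    thus "d / 2 * (r\<^sup>2 / (1 + r\<^sup>2) - \<Delta>) < ln (1 + r\<^sup>2) / 2 - ln (1 + (r * exp (- (d / 2)))\<^sup>2) / 2"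
      by (simp add: f_def)
  qed
qed

section \<open>From concentration on three circles to the zero count\<close>

theorem theorem1:
  fixes \<Delta> r :: real
  assumes "\<Delta> > 0" and "r > 0"
  shows "\<exists>A>0. \<exists>N0::nat. \<forall>N>N0. \<forall>(M :: 'a measure) \<alpha>.
           prob_space M \<longrightarrow> iid_std_complex_gaussian M N \<alpha> \<longrightarrow>
           (let E = {\<omega> \<in> space M.
                  \<bar>real (zeros_in_disk r (su2_poly N (\<lambda>j. \<alpha> j \<omega>)))
                     - real N * r\<^sup>2 / (1 + r\<^sup>2)\<bar> \<ge> \<Delta> * real N}
            in E \<in> sets M \<and> measure M E \<le> exp (- A * (real N)\<^sup>2))"
proof -
  define x where "x = r\<^sup>2 / (1 + r\<^sup>2)"
  define \<phi> where "\<phi> t = ln (1 + t\<^sup>2) / 2" for t :: real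
  \<comment> \<open>Half of \<open>\<Delta>\<close> is spent on replacing the derivative by
    difference quotients, the other half on the random fluctuations.\<close>
  have "\<Delta> / 2 > 0" using assms by simp
  from ln_one_plus_square_log_derivative[OF assms(2) this] obtain h where h: "h > 0"
    "\<phi> (r * exp h) - \<phi> r < h * (x + \<Delta> / 2)" "\<phi> r - \<phi> (r * exp (- h)) > h * (x - \<Delta> / 2)"
    unfolding x_def \<phi>_def by blast
  define t1 where "t1 = r * exp h"
  define t2 where "t2 = r * exp (- h)"
  have t: "r < t1" "t2 < r" "t1 > 0" "t2 > 0" "ln (t1 / r) = h" "ln (r / t2) = h"
    using h assms(2) by (simp_all add: t1_def t2_def) (simp add: exp_minus field_simps)
  \<comment> \<open>A difference of two logarithms has error at most 2 delta N, which after division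
    by \<open>h\<close> is half of \<open>\<Delta> * N\<close>.\<close>
  define \<delta> where "\<delta> = \<Delta> * h / 4"
  have \<delta>: "\<delta> > 0" using assms h by (simp add: \<delta>_def)
  \<comment> \<open>Packing the quantifiers over \<open>M\<close> and \<open>\<alpha>\<close> into
    \<open>good\<close> lets the rate and the threshold be chosen as functions of the radius
    alone.\<close>
  define good where "good A N s \<longleftrightarrow>
    (\<forall>(M :: 'a measure) \<alpha>. prob_space M \<longrightarrow> iid_std_complex_gaussian M N \<alpha> \<longrightarrow>
    (\<exists>F\<in>sets M. measure M F \<le> exp (- A * (real N)\<^sup>2) \<and>
      (\<forall>\<omega>\<in>space M - F. su2_poly N (\<lambda>j. \<alpha> j \<omega>) \<noteq> 0 \<and>
        \<bar>ln (mahler s (su2_poly N (\<lambda>j. \<alpha> j \<omega>))) - real N * \<phi> s\<bar> \<le> \<delta> * real N)))"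
    for A s :: real and N
  have "\<exists>A>0. \<exists>N0. \<forall>N>N0. good A N s" if "s > 0" for s
    using ln_mahler_su2_poly_concentration[OF that \<delta>, where 'a = 'a] unfolding good_def \<phi>_def .
  then obtain A N0 where A: "\<And>s. s > 0 \<Longrightarrow> A s > 0" and
    N0: "\<And>s N. s > 0 \<Longrightarrow> N > N0 s \<Longrightarrow> good (A s) N s" by metis
  \<comment> \<open>Halving the smallest rate leaves \<open>exp (B * (real N)\<^sup>2)\<close> to
    absorb the factor 3 from the three exceptional sets.\<close>
  define B where "B = min (A r) (min (A t1) (A t2)) / 2"
  have B: "B > 0" "2 * B \<le> A r" "2 * B \<le> A t1" "2 * B \<le> A t2"
    using A t assms by (auto simp: B_def)
  have "eventually (\<lambda>N. 3 \<le> exp (B * (real N)\<^sup>2)) sequentially" using B(1) by real_asymp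
  hence "eventually (\<lambda>N. N > N0 r \<and> N > N0 t1 \<and> N > N0 t2 \<and> N > 0 \<and> 3 \<le> exp (B * (real N)\<^sup>2)) sequentially"
    using eventually_gt_at_top[of "N0 r"] eventually_gt_at_top[of "N0 t1"]
      eventually_gt_at_top[of "N0 t2"] eventually_gt_at_top[of 0] by eventually_elim simp
  then obtain K where K: "\<And>N. N > K \<Longrightarrow> N > N0 r \<and> N > N0 t1 \<and> N > N0 t2 \<and> N > 0 \<and> 3 \<le> exp (B * (real N)\<^sup>2)"
    unfolding eventually_sequentially by (metis less_imp_le)
  show ?thesis
  proof (intro exI[of _ B] exI[of _ K] conjI allI impI B(1))
    fix N :: nat and M :: "'a measure" and \<alpha>
    assume N: "N > K" and "prob_space M" and iid: "iid_std_complex_gaussian M N \<alpha>"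
    interpret prob_space M by fact
    have [measurable]: "\<alpha> j \<in> borel_measurable M" if "j \<le> N" for j
      using iid that by (auto simp: iid_std_complex_gaussian_def intro: std_complex_gaussian_measurable)
    define P where "P \<omega> = su2_poly N (\<lambda>j. \<alpha> j \<omega>)" for \<omega>
    define n where "n \<omega> = real (zeros_in_disk r (P \<omega>))" for \<omega>
    have n_meas[measurable]: "n \<in> borel_measurable M"
      unfolding n_def
    proof (rule measurable_zeros_in_disk[OF assms(2)])
      show "(\<lambda>\<omega>. poly (P \<omega>) z) \<in> borel_measurable M" for z
        unfolding P_def poly_su2_poly by measurable
      show "{\<omega> \<in> space M. P \<omega> = 0} \<in> sets M"
        unfolding P_def su2_poly_eq_0_iff atMost_iff[symmetric] Ball_def[symmetric]
        by (intro sets.sets_Collect_finite_All) measurable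
    qed
    define E where "E = {\<omega> \<in> space M. \<bar>n \<omega> - real N * r\<^sup>2 / (1 + r\<^sup>2)\<bar> \<ge> \<Delta> * real N}"
    have E: "E \<in> sets M" unfolding E_def by measurable
    define bad where "bad s F \<longleftrightarrow> F \<in> sets M \<and> prob F \<le> exp (- 2 * B * (real N)\<^sup>2) \<and>
        (\<forall>\<omega>\<in>space M - F. P \<omega> \<noteq> 0 \<and> \<bar>ln (mahler s (P \<omega>)) - real N * \<phi> s\<bar> \<le> \<delta> * real N)"
      for s F
    have "\<exists>F. bad s F" if "s \<in> {r, t1, t2}" for s
    proof -
      have "s > 0" "2 * B \<le> A s" "N > N0 s" using that assms t B K[OF N] by auto
      with N0[of s N] iid \<open>prob_space M\<close> obtain F where F: "F \<in> sets M"
        "prob F \<le> exp (- A s * (real N)\<^sup>2)"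
        "\<forall>\<omega>\<in>space M - F. P \<omega> \<noteq> 0 \<and> \<bar>ln (mahler s (P \<omega>)) - real N * \<phi> s\<bar> \<le> \<delta> * real N"
        unfolding good_def P_def by blast
      have "exp (- A s * (real N)\<^sup>2) \<le> exp (- 2 * B * (real N)\<^sup>2)"
        using \<open>2 * B \<le> A s\<close> by (simp add: mult_right_mono)
      with F(2) have "prob F \<le> exp (- 2 * B * (real N)\<^sup>2)" by (rule order_trans)
      with F show ?thesis unfolding bad_def by blast
    qed
    then obtain F where "\<And>s. s \<in> {r, t1, t2} \<Longrightarrow> bad s (F s)" by metis
    hence F: "\<And>s. s \<in> {r, t1, t2} \<Longrightarrow> F s \<in> sets M"
      "\<And>s. s \<in> {r, t1, t2} \<Longrightarrow> prob (F s) \<le> exp (- 2 * B * (real N)\<^sup>2)"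
      "\<And>s \<omega>. s \<in> {r, t1, t2} \<Longrightarrow> \<omega> \<in> space M - F s \<Longrightarrow> P \<omega> \<noteq> 0"
      "\<And>s \<omega>. s \<in> {r, t1, t2} \<Longrightarrow> \<omega> \<in> space M - F s \<Longrightarrow>
        \<bar>ln (mahler s (P \<omega>)) - real N * \<phi> s\<bar> \<le> \<delta> * real N"
      unfolding bad_def by blast+
    \<comment> \<open>Off the three exceptional sets the count is squeezed strictly within
      \<open>\<Delta> * N\<close> of its limit value. The strictness comes from the strict slope
      inequalities and \<open>N > 0\<close>, and it contradicts the non-strict deviation in
      \<open>E\<close>.\<close>
    have "E \<subseteq> F r \<union> F t1 \<union> F t2"
    proof (rule subsetI, rule ccontr)
      fix \<omega> assume \<omega>: "\<omega> \<in> E" "\<omega> \<notin> F r \<union> F t1 \<union> F t2"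
      have sp: "\<omega> \<in> space M" using \<omega> by (simp add: E_def)
      have J: "\<bar>ln (mahler s (P \<omega>)) - real N * \<phi> s\<bar> \<le> \<delta> * real N" if "s \<in> {r, t1, t2}" for s
        using F(4)[OF that] \<omega> that sp by auto
      have nz: "P \<omega> \<noteq> 0" using F(3)[of r \<omega>] \<omega> sp by auto
      have N0: "real N > 0" using K[OF N] by simp
      have "n \<omega> * h \<le> ln (mahler t1 (P \<omega>)) - ln (mahler r (P \<omega>))"
        using zeros_in_disk_le_ln_mahler[OF nz assms(2) t(1)] by (simp add: n_def t)
      also have "\<dots> \<le> real N * (\<phi> t1 - \<phi> r) + 2 * \<delta> * real N"
        using J[of t1] J[of r] by (simp add: algebra_simps)
      also have "\<dots> < real N * (h * (x + \<Delta> / 2)) + 2 * \<delta> * real N"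
        using h(2) N0 by (simp add: t1_def)
      also have "\<dots> = (real N * x + \<Delta> * real N) * h" by (simp add: \<delta>_def field_simps)
      finally have upper: "n \<omega> < real N * x + \<Delta> * real N" using h(1) by simp
      have "(real N * x - \<Delta> * real N) * h = real N * (h * (x - \<Delta> / 2)) - 2 * \<delta> * real N"
        by (simp add: \<delta>_def field_simps)
      also have "\<dots> < real N * (\<phi> r - \<phi> t2) - 2 * \<delta> * real N"
        using h(3) N0 by (simp add: t2_def)
      also have "\<dots> \<le> ln (mahler r (P \<omega>)) - ln (mahler t2 (P \<omega>))"
        using J[of t2] J[of r] by (simp add: algebra_simps)
      also have "\<dots> \<le> n \<omega> * h"
        using zeros_in_disk_ge_ln_mahler[OF nz t(4) t(2)] by (simp add: n_def t)
      finally have "real N * x - \<Delta> * real N < n \<omega>" using h(1) by simp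
      with upper have "\<bar>n \<omega> - real N * x\<bar> < \<Delta> * real N" by linarith
      thus False using \<omega>(1) by (simp add: E_def x_def)
    qed
    hence "prob E \<le> prob (F r \<union> F t1 \<union> F t2)"
      using F(1) by (intro finite_measure_mono) auto
    also have "\<dots> \<le> prob (F r) + prob (F t1) + prob (F t2)"
      using F(1) by (intro order_trans[OF measure_Un_le] add_right_mono measure_Un_le) auto
    also have "\<dots> \<le> 3 * exp (- 2 * B * (real N)\<^sup>2)"
      using F(2)[of r] F(2)[of t1] F(2)[of t2] by simp
    also have "\<dots> \<le> exp (B * (real N)\<^sup>2) * exp (- 2 * B * (real N)\<^sup>2)"
      using K[OF N] by (intro mult_right_mono) auto
    also have "\<dots> = exp (- B * (real N)\<^sup>2)" by (simp add: exp_add[symmetric])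
    finally have "prob E \<le> exp (- B * (real N)\<^sup>2)" .
    with E show "let E = {\<omega> \<in> space M.
                  \<bar>real (zeros_in_disk r (su2_poly N (\<lambda>j. \<alpha> j \<omega>)))
                     - real N * r\<^sup>2 / (1 + r\<^sup>2)\<bar> \<ge> \<Delta> * real N}
            in E \<in> sets M \<and> measure M E \<le> exp (- B * (real N)\<^sup>2)"
      unfolding Let_def E_def n_def P_def by (rule conjI)
  qed
qed

end
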